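(* For any $\epsilon,\delta>0$ and $\Delta\in\mathbb{N}$, there exists a $C>0$ such that the following holds. Let $G$ be an $n$-vertex $\Delta$-degenerate connected graph, choose $R\sim G(n,\delta/n)$ on the same vertex set and let $G'\coloneqq G\cup R$. Then, asymptotically almost surely (as $n\to\infty$), \[\bar t_{\mathrm{mix}}(G',\epsilon)\leq C\log n.\]
   Context: Graphs are finite and simple, and $n$-vertex graphs have vertex set $[n]=\{1,\dots,n\}$. A graph $G$ is $\Delta$-degenerate if there is an ordering of its vertices such that each vertex has at most $\Delta$ neighbours that precede it in the ordering. $G(n,p)$ is the binomial random graph on $[n]$, where each pair of vertices is an edge independently with probability $p$. $G\cup R$ is the graph on $[n]$ with edge set $E(G)\cup E(R)$. "Asymptotically almost surely" refers to any sequence of graphs $G$ satisfying the hypotheses (with fixed $\epsilon,\delta,\Delta$, and hence fixed $C$) whose number of vertices $n$ tends to infinity: along any such sequence, the probability of the stated event tends to $1$. The lazy random walk on a connected graph $H$ has transition matrix $P_H$ given by $P_H(i,i)=1/2$ and, for $i\neq j$, $P_H(i,j)=1/(2\deg_H(i))$ if $ij\in E(H)$ and $P_H(i,j)=0$ otherwise. Its stationary distribution is $\pi_H(u)=\deg_H(u)/(2|E(H)|)$. For $u\in V(H)$, $\mu_0^u$ is the point mass at $u$. Total variation distance is $d_{\mathrm{TV}}(\mu,\nu)=\frac12\sum_{v}|\mu(v)-\nu(v)|$. The average $\epsilon$-mixing time of a connected graph $H$ is \[\bar t_{\mathrm{mix}}(H,\epsilon)=\min\Big\{t\in\mathbb{N}_0:\frac{1}{|V(H)|}\sum_{u\in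 V(H)}d_{\mathrm{TV}}(\mu_0^uP_H^t,\pi_H)\leq\epsilon\Big\}.\] *)

theory Defs
  imports
    "HOL-Probability.Probability"
    "HOL-Library.Ramsey"
    "HOL-Combinatorics.Multiset_Permutations"
begin

text \<open>
  A graph is given by its vertex set \<open>V\<close> and its set \<open>E\<close> of edges, an edge being a two-element
  subset of \<open>V\<close>; so loops and multiple edges are excluded.
\<close>

definition simple_graph :: "'a set \<Rightarrow> 'a set set \<Rightarrow> bool" where
  "simple_graph V E \<longleftrightarrow> finite V \<and> E \<subseteq> nsets V 2"

definition connected_graph :: "'a set \<Rightarrow> 'a set set \<Rightarrow> bool" where
  "connected_graph V E \<longleftrightarrow>
     simple_graph V E \<and> V \<noteq> {} \<and> (\<forall>u\<in>V. \<forall>v\<in>V. (u, v) \<in> {(x, y). {x, y} \<in> E}\<^sup>*)"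

definition degenerate :: "nat \<Rightarrow> 'a set \<Rightarrow> 'a set set \<Rightarrow> bool" where
  "degenerate d V E \<longleftrightarrow>
     (\<exists>xs \<in> permutations_of_set V. \<forall>i < length xs. card {j. j < i \<and> {xs ! j, xs ! i} \<in> E} \<le> d)"

definition graph_degree :: "'a set set \<Rightarrow> 'a \<Rightarrow> nat" where
  "graph_degree E v = card {e \<in> E. v \<in> e}"

definition lazy_walk_matrix :: "'a set set \<Rightarrow> 'a \<Rightarrow> 'a \<Rightarrow> real" where
  "lazy_walk_matrix E i j =
     (if i = j then 1 / 2
      else if {i, j} \<in> E then 1 / (2 * real (graph_degree E i))
      else 0)"

definition stationary_dist :: "'a set set \<Rightarrow> 'a \<Rightarrow> real" where
  "stationary_dist E u = real (graph_degree E u) / (2 * real (card E))"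

definition point_mass :: "'a \<Rightarrow> 'a \<Rightarrow> real" where
  "point_mass u v = (if v = u then 1 else 0)"

text \<open>Product of a row vector and a square matrix, both indexed by \<open>V\<close>.\<close>

definition row_mult :: "'a set \<Rightarrow> ('a \<Rightarrow> 'a \<Rightarrow> real) \<Rightarrow> ('a \<Rightarrow> real) \<Rightarrow> 'a \<Rightarrow> real" where
  "row_mult V P \<mu> = (\<lambda>v. \<Sum>w\<in>V. \<mu> w * P w v)"

text \<open>The distribution \<open>\<mu>\<^sub>0\<^sup>u P\<^sup>t\<close>, obtained by multiplying \<open>\<mu>\<^sub>0\<^sup>u\<close> by \<open>P\<close> from the right \<open>t\<close> times.\<close>

definition walk_dist :: "'a set \<Rightarrow> 'a set set \<Rightarrow> 'a \<Rightarrow> nat \<Rightarrow> 'a \<Rightarrow> real" where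
  "walk_dist V E u t = (row_mult V (lazy_walk_matrix E) ^^ t) (point_mass u)"

definition tv_dist :: "'a set \<Rightarrow> ('a \<Rightarrow> real) \<Rightarrow> ('a \<Rightarrow> real) \<Rightarrow> real" where
  "tv_dist V \<mu> \<nu> = 1 / 2 * (\<Sum>v\<in>V. \<bar>\<mu> v - \<nu> v\<bar>)"

text \<open>
  The infimum is taken in \<^typ>\<open>enat\<close>: it is the minimum if some \<open>t\<close> qualifies (which is always the
  case for connected graphs and \<open>\<epsilon> > 0\<close>), and \<open>\<infinity>\<close>, rather than an unspecified number, otherwise.
\<close>

definition avg_mixing_time :: "'a set \<Rightarrow> 'a set set \<Rightarrow> real \<Rightarrow> enat" where
  "avg_mixing_time V E \<epsilon> =
     Inf (enat ` {t. 1 / real (card V) *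
       (\<Sum>u\<in>V. tv_dist V (walk_dist V E u t) (stationary_dist E)) \<le> \<epsilon>})"

text \<open>
  The distribution of the edge set of \<open>G(n,p)\<close>. Since \<^const>\<open>bernoulli_pmf\<close> truncates its parameter
  to the unit interval, \<open>p > 1\<close> is read as \<open>p = 1\<close>; for \<open>p = \<delta> / n\<close> this concerns only \<open>n < \<delta>\<close>.
\<close>

definition gnp :: "nat \<Rightarrow> real \<Rightarrow> nat set set pmf" where
  "gnp n p = map_pmf (\<lambda>f. {e \<in> nsets {1..n} 2. f e})
     (Pi_pmf (nsets {1..n} 2) False (\<lambda>_. bernoulli_pmf p))"

end

theory Submission
  imports Defs
begin

text \<open>
  Let \<open>f\<^sub>t\<close> be the density of the walk with respect to the degrees. Its entropy decreases from at most
  \<open>0\<close> to at least \<open>- ln (2|E|)\<close>, so among \<open>C ln n\<close> steps there is one at which the entropy, averaged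
  over the starting vertex, drops by only \<open>O(1/C)\<close>. By Pinsker's inequality the edgewise oscillation
  (the \<open>L\<^sup>1\<close> norm of the gradient) of \<open>f\<^sub>t\<close> is then small on average.

  A typical \<open>G \<union> R\<close> has the property that every vertex set with linear volume and linear co-volume has
  linearly many boundary edges: for small sets because \<open>G\<close> is degenerate, for large ones because the
  connected graph \<open>G\<close> has only few sets with a small boundary, and a union bound over these is
  affordable. Removing a maximal badly expanding set \<open>B\<close>, which has small volume, leaves an
  expander, on which the \<open>L\<^sup>1\<close> Cheeger inequality makes \<open>f\<^sub>t\<close> almost constant. Finally, \<open>B\<close> receives
  little mass on average, since counting measure is dominated by the invariant degree measure.
\<close>

section \<open>Cut cones and entropy\<close>

text \<open>Up to an additive constant, \<open>f\<close> is a nonnegative combination of indicators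
  of its superlevel sets, and \<open>\<bar>f x - f y\<bar>\<close> is the same combination of cut
  semimetrics. So a linear functional, even one with weights of mixed sign, has to be tested on cuts
  only. The induction peels off the top level of \<open>f\<close>.\<close>

lemma nonneg_on_cut_cone:
  fixes w :: "'a \<Rightarrow> 'a \<Rightarrow> real" and f :: "'a \<Rightarrow> real"
  assumes "finite A"
    and cuts: "\<And>S. S \<subseteq> A \<Longrightarrow> 0 \<le> (\<Sum>x\<in>A. \<Sum>y\<in>A. w x y * \<bar>indicator S x - indicator S y\<bar>)"
  shows "0 \<le> (\<Sum>x\<in>A. \<Sum>y\<in>A. w x y * \<bar>f x - f y\<bar>)"
proof (induction "card (f ` A)" arbitrary: f rule: less_induct)
  case (less f)
  show ?case
  proof (cases "\<exists>c. \<forall>x\<in>A. f x = c")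
    case True
    then obtain c where "\<And>x. x \<in> A \<Longrightarrow> f x = c" by blast
    then have "(\<Sum>x\<in>A. \<Sum>y\<in>A. w x y * \<bar>f x - f y\<bar>) = (\<Sum>x\<in>A. \<Sum>y\<in>A. 0)"
      by (intro sum.cong refl) simp
    then show ?thesis by simp
  next
    case False
    define m where "m = Max (f ` A)"
    define m' where "m' = Max (f ` A - {m})"
    have fin: "finite (f ` A)" using \<open>finite A\<close> by simp
    have "A \<noteq> {}" using False by force
    then have ne: "f ` A \<noteq> {}" by simp
    have "f ` A - {c} \<noteq> {}" for c
    proof
      assume *: "f ` A - {c} = {}"
      have "f x = c" if "x \<in> A" for x using * that by blast
      then show False using False by blast
    qed
    then have ne': "f ` A - {m} \<noteq> {}" .
    have m': "m' \<in> f ` A - {m}" unfolding m'_def by (rule Max_in[OF finite_Diff[OF fin] ne'])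
    have lt: "m' < m" using m' fin Max_ge[of "f ` A" m'] by (auto simp: m_def less_le)
    have le: "f x \<le> m'" if "x \<in> A" "f x \<noteq> m" for x
      using that fin unfolding m'_def by (intro Max_ge) auto
    \<comment> \<open>Lowering the maximum \<open>m\<close> to the second largest value
      \<open>m'\<close> removes one value, so the induction hypothesis applies to \<open>g\<close>;
      on \<open>A\<close> the difference of \<open>f\<close> and \<open>g\<close> is
      \<open>m - m'\<close> times the indicator of \<open>S\<close>.\<close>
    define S where "S = {x \<in> A. f x = m}"
    define g where "g x = min (f x) m'" for x
    have gS: "g x = (if x \<in> S then m' else f x)" if "x \<in> A" for x
      using le[OF that] lt that by (auto simp: g_def S_def)
    have sub: "g ` A \<subseteq> f ` A - {m}"
    proof
      fix z assume "z \<in> g ` A"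
      then obtain x where "x \<in> A" "z = g x" by auto
      then show "z \<in> f ` A - {m}" using m' gS[of x] by (cases "x \<in> S") (auto simp: S_def)
    qed
    have "card (g ` A) \<le> card (f ` A - {m})" using sub fin by (intro card_mono) auto
    also have "\<dots> < card (f ` A)" unfolding m_def by (rule card_Diff1_less[OF fin Max_in[OF fin ne]])
    finally have IH: "0 \<le> (\<Sum>x\<in>A. \<Sum>y\<in>A. w x y * \<bar>g x - g y\<bar>)" by (rule less)
    \<comment> \<open>There is no cancellation: \<open>g\<close> attains its maximum
      \<open>m'\<close> on all of \<open>S\<close>, so across the cut the change of \<open>g\<close>
      and the jump \<open>m - m'\<close> have the same sign.\<close>
    have split: "\<bar>f x - f y\<bar> = \<bar>g x - g y\<bar> + (m - m') * \<bar>indicator S x - indicator S y\<bar>"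
      if "x \<in> A" "y \<in> A" for x y
    proof -
      have "g x \<le> m'" "g y \<le> m'" by (auto simp: g_def)
      moreover have "f z = (if z \<in> S then m else g z)" "z \<in> S \<Longrightarrow> g z = m'" if "z \<in> A" for z
        using gS[OF that] that by (auto simp: S_def)
      ultimately show ?thesis using lt that by (cases "x \<in> S"; cases "y \<in> S") simp_all
    qed
    have "(\<Sum>x\<in>A. \<Sum>y\<in>A. w x y * \<bar>f x - f y\<bar>) =
        (\<Sum>x\<in>A. \<Sum>y\<in>A. w x y * \<bar>g x - g y\<bar> + (m - m') * (w x y * \<bar>indicator S x - indicator S y\<bar>))"
      by (intro sum.cong refl) (auto simp: split algebra_simps)
    also have "\<dots> = (\<Sum>x\<in>A. \<Sum>y\<in>A. w x y * \<bar>g x - g y\<bar>) +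
        (m - m') * (\<Sum>x\<in>A. \<Sum>y\<in>A. w x y * \<bar>indicator S x - indicator S y\<bar>)"
      by (simp add: sum.distrib sum_distrib_left)
    also have "\<dots> \<ge> 0"
      using IH lt cuts[of S] by (auto simp: S_def)
    finally show ?thesis .
  qed
qed

text \<open>This is \<open>ln s \<le> s - 1\<close> at \<open>s = sqrt (b / a)\<close>. It compares
  the integrands of the squared Hellinger distance and of the relative entropy. The third hypothesis
  excludes \<open>b = 0 < a\<close>, where the relative entropy should be infinite.\<close>

lemma sqrt_diff_squared_le_relative_entropy:
  fixes a b :: real
  assumes "a \<ge> 0" "b \<ge> 0" "b = 0 \<Longrightarrow> a = 0"
  shows "(sqrt a - sqrt b)\<^sup>2 \<le> a * ln a - a * ln b - a + b"
proof (cases "a = 0")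
  case False
  then have pos: "a > 0" "b > 0" using assms by force+
  have "sqrt (b / a) - 1 \<ge> ln (sqrt (b / a))"
    using pos ln_le_minus_one[of "sqrt (b / a)"] by simp
  also have "ln (sqrt (b / a)) = (ln b - ln a) / 2"
    using pos by (simp add: ln_sqrt ln_div)
  finally have "2 * a * (sqrt (b / a) - 1) \<ge> 2 * a * ((ln b - ln a) / 2)"
    using pos by (intro mult_left_mono) auto
  moreover have "2 * a * ((ln b - ln a) / 2) = a * ln b - a * ln a"
    by (simp add: field_simps)
  moreover have "a * sqrt (b / a) = sqrt a * sqrt b"
    using pos by (simp add: real_sqrt_divide field_simps)
  ultimately show ?thesis
    using pos by (simp add: power2_diff algebra_simps)
qed (use assms in auto)

text \<open>The tangent line of \<open>x * ln x\<close> at \<open>b\<close> lies below the graph.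
  With \<open>b\<close> the constant density \<open>1 / vol E V\<close> this bounds the entropy of
  the walk from below.\<close>

lemma relative_entropy_nonneg:
  fixes a b :: real
  assumes "a \<ge> 0" "b > 0"
  shows "a * ln b + a - b \<le> a * ln a"
  using sqrt_diff_squared_le_relative_entropy[of a b] zero_le_power2[of "sqrt a - sqrt b"] assms
  by linarith

text \<open>The entropy drop of a reversible step is a relative entropy, so this is a form of Pinsker's inequality.\<close>

lemma entropy_drop_ge:
  fixes q :: "'a \<Rightarrow> 'a \<Rightarrow> real" and d f g :: "'a \<Rightarrow> real"
  assumes V: "finite V"
    and q: "\<And>x y. x \<in> V \<Longrightarrow> y \<in> V \<Longrightarrow> 0 \<le> q x y"
    and sym: "\<And>x y. x \<in> V \<Longrightarrow> y \<in> V \<Longrightarrow> q x y = q y x"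
    and d: "\<And>x. x \<in> V \<Longrightarrow> (\<Sum>y\<in>V. q x y) = d x"
    and f: "\<And>x. x \<in> V \<Longrightarrow> 0 \<le> f x"
    and dpos: "\<And>x. x \<in> V \<Longrightarrow> 0 < d x"
    and g: "\<And>x. x \<in> V \<Longrightarrow> d x * g x = (\<Sum>y\<in>V. q x y * f y)"
  shows "(\<Sum>x\<in>V. \<Sum>y\<in>V. q x y * \<bar>f y - g x\<bar>)\<^sup>2 \<le>
      4 * (\<Sum>x\<in>V. d x * f x) * ((\<Sum>x\<in>V. d x * (f x * ln (f x))) - (\<Sum>x\<in>V. d x * (g x * ln (g x))))"
proof -
  have g0: "0 \<le> g x" if "x \<in> V" for x
  proof -
    have "0 \<le> d x * g x" using that q f by (auto simp: g intro!: sum_nonneg)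
    then show ?thesis using dpos[OF that] by (simp add: zero_le_mult_iff)
  qed
  \<comment> \<open>By symmetry both marginals of \<open>q\<close> are \<open>d\<close>; in
    particular \<open>f\<close> and \<open>g\<close> have the same mass.\<close>
  have col: "(\<Sum>x\<in>V. \<Sum>y\<in>V. q x y * h y) = (\<Sum>x\<in>V. d x * h x)" for h :: "'a \<Rightarrow> real"
  proof -
    have "(\<Sum>x\<in>V. \<Sum>y\<in>V. q x y * h y) = (\<Sum>y\<in>V. \<Sum>x\<in>V. q y x * h y)"
      by (subst sum.swap) (auto intro!: sum.cong simp: sym)
    also have "\<dots> = (\<Sum>y\<in>V. d y * h y)"
      by (intro sum.cong refl) (simp add: d flip: sum_distrib_right)
    finally show ?thesis .
  qed
  have row: "(\<Sum>x\<in>V. \<Sum>y\<in>V. q x y * h x) = (\<Sum>x\<in>V. d x * h x)" for h :: "'a \<Rightarrow> real"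
    by (intro sum.cong refl) (simp add: d flip: sum_distrib_right)
  have dg: "(\<Sum>x\<in>V. d x * g x) = (\<Sum>x\<in>V. d x * f x)"
    using col[of f] by (simp add: g)
  let ?I = "\<lambda>h. \<Sum>(x, y)\<in>V \<times> V. q x y * h x y"
  have I: "(\<Sum>x\<in>V. \<Sum>y\<in>V. q x y * h x y) = ?I h" for h
    by (simp add: sum.cartesian_product)
  \<comment> \<open>The upper bound is the relative entropy of the weights
    \<open>q x y * f y\<close> with respect to \<open>q x y * g x\<close>. Its linear terms cancel
    because the masses agree, and in the cross term summation over \<open>y\<close> replaces
    \<open>f y\<close> by \<open>g x\<close>, which leaves exactly the entropy drop.\<close>
  have ent: "?I (\<lambda>x y. (sqrt (f y) - sqrt (g x))\<^sup>2) \<le>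
      (\<Sum>x\<in>V. d x * (f x * ln (f x))) - (\<Sum>x\<in>V. d x * (g x * ln (g x)))" (is "?D \<le> ?E")
  proof -
    have "q x y * (sqrt (f y) - sqrt (g x))\<^sup>2 \<le> q x y * (f y * ln (f y) - f y * ln (g x) - f y + g x)"
      if "x \<in> V" "y \<in> V" for x y
    proof (cases "q x y = 0")
      case False
      then have qp: "q x y > 0" using q that by force
      \<comment> \<open>Absolute continuity for the pointwise inequality: an average of nonnegative
        values vanishes only if all values of positive weight do.\<close>
      have "f y = 0" if "g x = 0"
      proof -
        have "(\<Sum>y\<in>V. q x y * f y) = 0" using g[OF \<open>x \<in> V\<close>] that by simp
        then have "q x y * f y = 0"
          using sum_nonneg_eq_0_iff[OF V, of "\<lambda>y. q x y * f y"] q f \<open>x \<in> V\<close> \<open>y \<in> V\<close> by auto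
        then show ?thesis using qp by simp
      qed
      then show ?thesis
        using qp that f g0 by (intro mult_left_mono sqrt_diff_squared_le_relative_entropy) auto
    qed simp
    then have "?D \<le> (\<Sum>x\<in>V. \<Sum>y\<in>V. q x y * (f y * ln (f y) - f y * ln (g x) - f y + g x))"
      unfolding I[symmetric] by (intro sum_mono)
    also have "\<dots> = (\<Sum>x\<in>V. \<Sum>y\<in>V. q x y * (f y * ln (f y))) - (\<Sum>x\<in>V. \<Sum>y\<in>V. (q x y * f y) * ln (g x))
        - (\<Sum>x\<in>V. \<Sum>y\<in>V. q x y * f y) + (\<Sum>x\<in>V. \<Sum>y\<in>V. q x y * g x)"
      by (simp add: sum.distrib sum_subtractf algebra_simps)
    also have "(\<Sum>x\<in>V. \<Sum>y\<in>V. (q x y * f y) * ln (g x)) = (\<Sum>x\<in>V. d x * (g x * ln (g x)))"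
      by (intro sum.cong refl) (simp add: mult.assoc[symmetric] g flip: sum_distrib_right)
    also have "(\<Sum>x\<in>V. \<Sum>y\<in>V. q x y * (f y * ln (f y))) = (\<Sum>x\<in>V. d x * (f x * ln (f x)))"
      by (rule col[of "\<lambda>y. f y * ln (f y)"])
    also have "(\<Sum>x\<in>V. \<Sum>y\<in>V. q x y * f y) = (\<Sum>x\<in>V. d x * f x)" by (rule col)
    also have "(\<Sum>x\<in>V. \<Sum>y\<in>V. q x y * g x) = (\<Sum>x\<in>V. d x * f x)" by (simp only: row dg)
    finally show ?thesis by simp
  qed
  have plus: "?I (\<lambda>x y. (sqrt (f y) + sqrt (g x))\<^sup>2) \<le> 4 * (\<Sum>x\<in>V. d x * f x)"
  proof -
    have "(sqrt (f y) + sqrt (g x))\<^sup>2 \<le> 2 * f y + 2 * g x" if "x \<in> V" "y \<in> V" for x y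
    proof -
      have "(sqrt (f y) + sqrt (g x))\<^sup>2 + (sqrt (f y) - sqrt (g x))\<^sup>2 = 2 * f y + 2 * g x"
        using that f g0 by (simp add: power2_sum power2_diff)
      then show ?thesis using zero_le_power2[of "sqrt (f y) - sqrt (g x)"] by linarith
    qed
    then have "?I (\<lambda>x y. (sqrt (f y) + sqrt (g x))\<^sup>2) \<le> (\<Sum>x\<in>V. \<Sum>y\<in>V. q x y * (2 * f y + 2 * g x))"
      unfolding I[symmetric] using q by (intro sum_mono mult_left_mono)
    also have "\<dots> = 2 * (\<Sum>x\<in>V. \<Sum>y\<in>V. q x y * f y) + 2 * (\<Sum>x\<in>V. \<Sum>y\<in>V. q x y * g x)"
      by (simp add: sum.distrib sum_distrib_left algebra_simps)
    also have "\<dots> = 4 * (\<Sum>x\<in>V. d x * f x)" by (simp only: row col dg)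
    finally show ?thesis .
  qed
  \<comment> \<open>Preparation for Cauchy-Schwarz: the squares of the first factors sum to at most
    the entropy drop, those of the second to at most four times the mass.\<close>
  have eq: "?I (\<lambda>x y. \<bar>f y - g x\<bar>) = (\<Sum>(x, y)\<in>V \<times> V.
      (sqrt (q x y) * \<bar>sqrt (f y) - sqrt (g x)\<bar>) * (sqrt (q x y) * (sqrt (f y) + sqrt (g x))))"
  proof (intro sum.cong refl, clarsimp)
    fix x y assume xy: "x \<in> V" "y \<in> V"
    have "\<bar>f y - g x\<bar> = \<bar>(sqrt (f y) - sqrt (g x)) * (sqrt (f y) + sqrt (g x))\<bar>"
      using xy f g0 by (simp add: algebra_simps)
    also have "\<dots> = \<bar>sqrt (f y) - sqrt (g x)\<bar> * (sqrt (f y) + sqrt (g x))"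
      using xy f g0 by (simp add: abs_mult)
    moreover have "sqrt (q x y) * sqrt (q x y) = q x y" using q[OF xy] by simp
    ultimately show "q x y * \<bar>f y - g x\<bar> =
        sqrt (q x y) * \<bar>sqrt (f y) - sqrt (g x)\<bar> * (sqrt (q x y) * (sqrt (f y) + sqrt (g x)))"
      by (metis mult.assoc mult.left_commute)
  qed
  have "(?I (\<lambda>x y. \<bar>f y - g x\<bar>))\<^sup>2 \<le> (\<Sum>(x, y)\<in>V \<times> V. (sqrt (q x y) * \<bar>sqrt (f y) - sqrt (g x)\<bar>)\<^sup>2) *
      (\<Sum>(x, y)\<in>V \<times> V. (sqrt (q x y) * (sqrt (f y) + sqrt (g x)))\<^sup>2)"
    unfolding eq using Cauchy_Schwarz_ineq_sum[of "\<lambda>(x, y). sqrt (q x y) * \<bar>sqrt (f y) - sqrt (g x)\<bar>"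
        "\<lambda>(x, y). sqrt (q x y) * (sqrt (f y) + sqrt (g x))" "V \<times> V"]
    by (simp add: case_prod_unfold)
  also have "(\<Sum>(x, y)\<in>V \<times> V. (sqrt (q x y) * \<bar>sqrt (f y) - sqrt (g x)\<bar>)\<^sup>2) = ?D"
    by (intro sum.cong refl) (auto simp: power_mult_distrib q)
  also have "(\<Sum>(x, y)\<in>V \<times> V. (sqrt (q x y) * (sqrt (f y) + sqrt (g x)))\<^sup>2) =
      ?I (\<lambda>x y. (sqrt (f y) + sqrt (g x))\<^sup>2)"
    by (intro sum.cong refl) (auto simp: power_mult_distrib q)
  also have "?D * ?I (\<lambda>x y. (sqrt (f y) + sqrt (g x))\<^sup>2) \<le> ?E * (4 * (\<Sum>x\<in>V. d x * f x))"
    using ent plus by (intro mult_mono order_trans[OF _ ent]) (auto intro!: sum_nonneg mult_nonneg_nonneg q)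
  finally show ?thesis by (simp add: I mult_ac)
qed

section \<open>Volumes, cuts and expanders\<close>

definition vol :: "'a set set \<Rightarrow> 'a set \<Rightarrow> real" where
  "vol E S = (\<Sum>v\<in>S. real (graph_degree E v))"

text \<open>Ordered pairs are counted: an edge between disjoint sets counts once, an edge inside
  \<open>S\<close> twice in \<open>ecount E S S\<close>. This makes \<open>ecount E S V\<close> the
  volume of \<open>S\<close> without correction terms. Likewise \<open>gradient\<close> sees every
  edge twice.\<close>

definition ecount :: "'a set set \<Rightarrow> 'a set \<Rightarrow> 'a set \<Rightarrow> real" where
  "ecount E S T = (\<Sum>x\<in>S. \<Sum>y\<in>T. of_bool ({x, y} \<in> E))"

definition gradient :: "'a set \<Rightarrow> 'a set set \<Rightarrow> ('a \<Rightarrow> real) \<Rightarrow> real" where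
  "gradient V E f = (\<Sum>x\<in>V. \<Sum>y\<in>V. of_bool ({x, y} \<in> E) * \<bar>f x - f y\<bar>)"

lemma vol_nonneg: "0 \<le> vol E S"
  by (simp add: vol_def sum_nonneg)

lemma ecount_nonneg: "0 \<le> ecount E S T"
  by (simp add: ecount_def sum_nonneg)

lemma ecount_commute: "ecount E S T = ecount E T S"
  unfolding ecount_def by (subst sum.swap) (simp add: insert_commute)

lemma gradient_nonneg: "0 \<le> gradient V E f"
  by (simp add: gradient_def sum_nonneg)

lemma simple_graph_finite: "simple_graph V E \<Longrightarrow> finite V" "simple_graph V E \<Longrightarrow> finite E"
  by (auto simp: simple_graph_def intro: finite_subset finite_imp_finite_nsets)

lemma simple_graph_edgeD:
  assumes "simple_graph V E" "{x, y} \<in> E"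
  shows "x \<in> V" "y \<in> V" "x \<noteq> y"
proof -
  have "{x, y} \<in> nsets V 2" using assms unfolding simple_graph_def by blast
  then show "x \<in> V" "y \<in> V" "x \<noteq> y" by auto
qed

lemma simple_graph_edgeE:
  assumes "simple_graph V E" "e \<in> E"
  obtains x y where "e = {x, y}" "x \<in> V" "y \<in> V" "x \<noteq> y"
  using assms unfolding simple_graph_def by (meson nsets2_E subsetD)

lemma graph_degree_eq_sum:
  assumes "simple_graph V E" "x \<in> V"
  shows "real (graph_degree E x) = (\<Sum>y\<in>V. of_bool ({x, y} \<in> E))"
proof -
  have "bij_betw (\<lambda>y. {x, y}) {y \<in> V. {x, y} \<in> E} {e \<in> E. x \<in> e}"
  proof (rule bij_betwI')
    fix e assume "e \<in> {e \<in> E. x \<in> e}"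
    then have e: "e \<in> E" "x \<in> e" by auto
    from simple_graph_edgeE[OF assms(1) e(1)] obtain a b where "e = {a, b}" "a \<in> V" "b \<in> V" .
    then obtain y where "e = {x, y}" "y \<in> V"
      using e(2) by (cases "x = a") (auto simp: insert_commute)
    then show "\<exists>y\<in>{y \<in> V. {x, y} \<in> E}. e = {x, y}" using e(1) by blast
  qed (auto simp: doubleton_eq_iff)
  then have "card {y \<in> V. {x, y} \<in> E} = graph_degree E x"
    unfolding graph_degree_def by (rule bij_betw_same_card)
  then have "real (graph_degree E x) = real (card {y \<in> V. {x, y} \<in> E})" by simp
  then show ?thesis
    using simple_graph_finite[OF assms(1)] by (simp add: Int_def of_bool_def sum.If_cases)
qed

lemma vol_eq_ecount: "simple_graph V E \<Longrightarrow> S \<subseteq> V \<Longrightarrow> vol E S = ecount E S V"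
  unfolding vol_def ecount_def by (intro sum.cong refl) (auto intro!: graph_degree_eq_sum)

lemma ecount_Un_right:
  "finite T \<Longrightarrow> finite T' \<Longrightarrow> T \<inter> T' = {} \<Longrightarrow> ecount E S (T \<union> T') = ecount E S T + ecount E S T'"
  unfolding ecount_def by (simp only: sum.union_disjoint sum.distrib)

lemma ecount_Un_left:
  "finite S \<Longrightarrow> finite S' \<Longrightarrow> S \<inter> S' = {} \<Longrightarrow> ecount E (S \<union> S') T = ecount E S T + ecount E S' T"
  by (subst (1 2 3) ecount_commute) (rule ecount_Un_right)

lemma ecount_mono_right: "finite T \<Longrightarrow> T' \<subseteq> T \<Longrightarrow> ecount E S T' \<le> ecount E S T"
  unfolding ecount_def by (intro sum_mono sum_mono2) auto

lemma vol_Diff: "finite V \<Longrightarrow> S \<subseteq> V \<Longrightarrow> vol E (V - S) = vol E V - vol E S"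
  by (simp add: vol_def sum_diff)

lemma vol_Un: "finite S \<Longrightarrow> finite S' \<Longrightarrow> S \<inter> S' = {} \<Longrightarrow> vol E (S \<union> S') = vol E S + vol E S'"
  by (simp add: vol_def sum.union_disjoint)

lemma vol_mono: "finite T \<Longrightarrow> S \<subseteq> T \<Longrightarrow> vol E S \<le> vol E T"
  unfolding vol_def by (intro sum_mono2) auto

lemma handshake:
  assumes "simple_graph V E"
  shows "vol E V = 2 * real (card E)"
proof -
  have "vol E V = (\<Sum>x\<in>V. \<Sum>e\<in>E. of_bool (x \<in> e))"
    using simple_graph_finite[OF assms]
    by (simp add: vol_def graph_degree_def Int_def of_bool_def sum.If_cases)
  also have "\<dots> = (\<Sum>e\<in>E. \<Sum>x\<in>V. of_bool (x \<in> e))"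
    by (rule sum.swap)
  also have "\<dots> = (\<Sum>e\<in>E. 2)"
  proof (intro sum.cong refl)
    fix e assume "e \<in> E"
    then have "e \<subseteq> V" "card e = 2"
      using assms by (auto simp: simple_graph_def nsets_def)
    moreover have "(\<Sum>x\<in>V. of_bool (x \<in> e)) = real (card (V \<inter> e))"
      using simple_graph_finite[OF assms] by (simp add: of_bool_def sum.If_cases)
    ultimately show "(\<Sum>x\<in>V. of_bool (x \<in> e)) = (2 :: real)"
      by (simp add: Int_absorb1)
  qed
  finally show ?thesis by simp
qed

text \<open>A second vertex forces all degrees to be positive, so that dividing by a degree is
  meaningful.\<close>

locale nontrivial_connected_graph =
  fixes V :: "'a set" and E :: "'a set set"
  assumes connected: "connected_graph V E" and card_ge_2: "2 \<le> card V"
begin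

lemma simple: "simple_graph V E"
  using connected by (simp add: connected_graph_def)

lemmas finV = simple_graph_finite(1)[OF simple]
lemmas finE = simple_graph_finite(2)[OF simple]

lemma degree_ge_1:
  assumes "x \<in> V" shows "1 \<le> graph_degree E x"
proof -
  have "V \<noteq> {x}" using card_ge_2 by auto
  then obtain y where y: "y \<in> V" "y \<noteq> x" using assms by blast
  have "(x, y) \<in> {(x, y). {x, y} \<in> E}\<^sup>*"
    using connected assms y by (simp add: connected_graph_def)
  then obtain z where "{x, z} \<in> E"
    using y by (auto elim: converse_rtranclE)
  then have "{e \<in> E. x \<in> e} \<noteq> {}" by auto
  then have "card {e \<in> E. x \<in> e} \<noteq> 0" using finE by simp
  then show ?thesis unfolding graph_degree_def by linarith
qed

lemma card_le_vol: "S \<subseteq> V \<Longrightarrow> real (card S) \<le> vol E S"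
proof -
  assume "S \<subseteq> V"
  then have "(\<Sum>x\<in>S. 1) \<le> vol E S"
    unfolding vol_def using degree_ge_1 by (intro sum_mono) auto
  then show ?thesis by simp
qed

lemma vol_pos: "0 < vol E V"
  using card_le_vol[of V] card_ge_2 by simp

text \<open>Let \<open>B\<close> be a maximal badly expanding set. The expansion hypothesis keeps
  its volume small, and a set \<open>S\<close> that expands badly inside \<open>V - B\<close> could
  be added to \<open>B\<close>.\<close>

lemma expander_core:
  fixes c \<eta> :: real
  assumes "0 < c" and \<eta>: "0 \<le> \<eta>" "3 * \<eta> \<le> vol E V"
    and exp: "\<And>S. S \<subseteq> V \<Longrightarrow> \<eta> \<le> vol E S \<Longrightarrow> \<eta> \<le> vol E (V - S) \<Longrightarrow> c * vol E V \<le> ecount E S (V - S)"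
  obtains B where "B \<subseteq> V" "vol E B \<le> \<eta>"
    "\<And>S. S \<subseteq> V - B \<Longrightarrow> 2 * vol E S \<le> vol E (V - B) \<Longrightarrow> c * vol E S \<le> ecount E S (V - B - S)"
proof -
  \<comment> \<open>The bound of two thirds leaves room for the enlargement: if \<open>B\<close> has
    at most a third of the volume and \<open>S\<close> at most half of what remains, their union has
    at most two thirds.\<close>
  define \<B> where "\<B> = {B. B \<subseteq> V \<and> ecount E B (V - B) \<le> c * vol E B \<and> 3 * vol E B \<le> 2 * vol E V}"
  have "{} \<in> \<B>" using vol_nonneg[of E V] by (auto simp: \<B>_def ecount_def vol_def)
  moreover have "finite \<B>" using finV by (simp add: \<B>_def)
  ultimately obtain B where B: "B \<in> \<B>" and max: "\<And>B'. B' \<in> \<B> \<Longrightarrow> B \<subseteq> B' \<Longrightarrow> B = B'"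
    using finite_has_maximal[of \<B>] by blast
  have BV: "B \<subseteq> V" and cutB: "ecount E B (V - B) \<le> c * vol E B" and volB: "3 * vol E B \<le> 2 * vol E V"
    using B by (auto simp: \<B>_def)
  \<comment> \<open>Otherwise \<open>B\<close> and its complement both have volume at least
    \<open>\<eta>\<close>, the complement because it holds a third of the total; the cut would then
    exceed \<open>c * vol E B\<close>.\<close>
  have small: "vol E B < \<eta> \<or> B = {}"
  proof (rule ccontr)
    assume "\<not> (vol E B < \<eta> \<or> B = {})"
    then have "c * vol E V \<le> ecount E B (V - B)"
      using volB \<eta> BV vol_Diff[OF finV BV, of E] by (intro exp) auto
    also have "\<dots> \<le> c * (2 / 3 * vol E V)"
      using cutB volB mult_left_mono[of "vol E B" "2 / 3 * vol E V" c] \<open>0 < c\<close> by linarith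
    also have "\<dots> < c * vol E V"
      using vol_pos \<open>0 < c\<close> by simp
    finally show False by simp
  qed
  then have volB_le: "vol E B \<le> \<eta>" using \<eta> by (auto simp: vol_def)
  moreover have "c * vol E S \<le> ecount E S (V - B - S)"
    if S: "S \<subseteq> V - B" "2 * vol E S \<le> vol E (V - B)" for S
  proof (cases "S = {}")
    case True
    then show ?thesis by (simp add: ecount_def vol_def)
  next
    case False
    have fin: "finite S" "finite B" using S BV finV by (auto intro: finite_subset)
    have disj: "S \<inter> B = {}" using S by auto
    have "B \<noteq> S \<union> B" using False S by auto
    then have notin: "S \<union> B \<notin> \<B>" using max[of "S \<union> B"] by blast
    have "3 * vol E B \<le> vol E V"
      using volB_le \<eta> by linarith
    then have "3 * vol E (S \<union> B) \<le> 2 * vol E V"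
      using S vol_Diff[OF finV BV, of E] vol_Un[OF fin disj, of E] by simp
    \<comment> \<open>By maximality the union expands. Edges from \<open>B\<close> to the rest
      account for at most \<open>c * vol E B\<close>, so those from \<open>S\<close> account for
      \<open>c * vol E S\<close>.\<close>
    then have "c * vol E (S \<union> B) < ecount E (S \<union> B) (V - (S \<union> B))"
      using notin S BV by (auto simp: \<B>_def)
    also have "\<dots> = ecount E S (V - B - S) + ecount E B (V - B - S)"
      using fin disj by (simp add: ecount_Un_left Diff_Un Diff_Diff_Int flip: Diff_insert)
         (simp add: Diff_eq Int_ac)
    also have "ecount E B (V - B - S) \<le> c * vol E B"
      using cutB ecount_mono_right[of "V - B" "V - B - S" E B] finV by auto
    finally show ?thesis using vol_Un[OF fin disj, of E] by (simp add: algebra_simps)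
  qed
  ultimately show ?thesis by (rule that[OF BV])
qed

text \<open>For indicator functions this is a cut inequality that follows from expansion; the cut
  cone lemma extends it to all \<open>f\<close>. The degrees are those of the whole graph, not of
  the graph induced on \<open>A\<close>.\<close>

lemma cut_cheeger:
  assumes "0 < c" and A: "A \<subseteq> V"
    and exp: "\<And>S. S \<subseteq> A \<Longrightarrow> 2 * vol E S \<le> vol E A \<Longrightarrow> c * vol E S \<le> ecount E S (A - S)"
  shows "(\<Sum>x\<in>A. \<Sum>y\<in>A. real (graph_degree E x) * real (graph_degree E y) * \<bar>f x - f y\<bar>)
    \<le> vol E A / c * gradient A E f"
proof -
  have finA: "finite A" using A finV finite_subset by blast
  \<comment> \<open>The claim is symmetric in \<open>S\<close> and \<open>A - S\<close>, so
    expansion may be applied to the lighter side, while the volume of the other side is bounded by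
    \<open>vol E A\<close>.\<close>
  have cut: "vol E S * vol E (A - S) \<le> vol E A / c * ecount E S (A - S)" if "S \<subseteq> A" for S
  proof -
    have aux: "vol E S * vol E (A - S) \<le> vol E A / c * ecount E S (A - S)"
      if "S \<subseteq> A" "2 * vol E S \<le> vol E A" for S
    proof -
      have "vol E S \<le> ecount E S (A - S) / c"
        using exp[OF that] \<open>0 < c\<close> by (simp add: pos_le_divide_eq mult.commute)
      then have "vol E S * vol E (A - S) \<le> (ecount E S (A - S) / c) * vol E A"
        using vol_mono[of A "A - S" E] finA \<open>0 < c\<close>
        by (intro mult_mono) (auto intro!: divide_nonneg_pos vol_nonneg ecount_nonneg)
      then show ?thesis by (simp add: mult_ac)
    qed
    show ?thesis
    proof (cases "2 * vol E S \<le> vol E A")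
      case False
      then have "2 * vol E (A - S) \<le> vol E A"
        using vol_Diff[OF finA that, of E] by simp
      from aux[OF _ this] that show ?thesis
        by (simp add: double_diff ecount_commute[of E S] mult.commute)
    qed (use aux that in auto)
  qed
  define w where "w x y = vol E A / c * of_bool ({x, y} \<in> E)
      - real (graph_degree E x) * real (graph_degree E y)" for x y
  have "0 \<le> (\<Sum>x\<in>A. \<Sum>y\<in>A. w x y * \<bar>indicator S x - indicator S y\<bar>)" if "S \<subseteq> A" for S
  proof -
    have wcut: "(\<Sum>x\<in>S. \<Sum>y\<in>A - S. w x y) = vol E A / c * ecount E S (A - S) - vol E S * vol E (A - S)"
    proof -
      have "vol E S * vol E (A - S) = (\<Sum>x\<in>S. \<Sum>y\<in>A - S. real (graph_degree E x) * real (graph_degree E y))"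
        by (simp only: vol_def sum_product)
      then show ?thesis
        by (simp only: w_def sum_subtractf ecount_def sum_distrib_left)
    qed
    have wsym: "w x y = w y x" for x y
      by (simp add: w_def insert_commute mult.commute)
    have finS: "finite S" using that finA finite_subset by blast
    \<comment> \<open>Every crossing pair occurs in both orders, and by symmetry of \<open>w\<close>
      both orders contribute the sum in \<open>wcut\<close>.\<close>
    have "(\<Sum>x\<in>A. \<Sum>y\<in>A. w x y * \<bar>indicator S x - indicator S y\<bar>) =
        (\<Sum>x\<in>A. \<Sum>y\<in>A. (if x \<in> S then if y \<in> A - S then w x y else 0 else 0)
           + (if y \<in> S then if x \<in> A - S then w y x else 0 else 0))"
      by (intro sum.cong refl) (auto simp: indicator_def wsym)
    also have "\<dots> = (\<Sum>x\<in>A. \<Sum>y\<in>A. (if x \<in> S then if y \<in> A - S then w x y else 0 else 0))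
           + (\<Sum>x\<in>A. \<Sum>y\<in>A. (if y \<in> S then if x \<in> A - S then w y x else 0 else 0))"
      by (simp only: sum.distrib)
    also have "(\<Sum>x\<in>A. \<Sum>y\<in>A. (if y \<in> S then if x \<in> A - S then w y x else 0 else 0)) =
        (\<Sum>x\<in>A. \<Sum>y\<in>A. (if x \<in> S then if y \<in> A - S then w x y else 0 else 0))"
      by (subst sum.swap) simp
    also have "(\<Sum>x\<in>A. \<Sum>y\<in>A. (if x \<in> S then if y \<in> A - S then w x y else 0 else 0)) =
        (\<Sum>x\<in>A. if x \<in> S then (\<Sum>y\<in>A. if y \<in> A - S then w x y else 0) else 0)"
      by (intro sum.cong refl) simp
    also have "\<dots> = (\<Sum>x\<in>S. \<Sum>y\<in>A - S. w x y)"
    proof -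
      have "(\<Sum>y\<in>A. if y \<in> A - S then w x y else 0) = (\<Sum>y\<in>A - S. w x y)" for x
        using sum.inter_restrict[OF finA, of "w x" "A - S"] by (simp add: Int_absorb1)
      moreover have "(\<Sum>x\<in>A. if x \<in> S then h x else 0) = (\<Sum>x\<in>S. h x)" for h :: "'a \<Rightarrow> real"
        using sum.inter_restrict[OF finA, of h S] that by (simp add: Int_absorb1)
      ultimately show ?thesis by (simp only:)
    qed
    finally show ?thesis using wcut cut[OF that] by simp
  qed
  from nonneg_on_cut_cone[OF finA this, of f]
  have "0 \<le> (\<Sum>x\<in>A. \<Sum>y\<in>A. w x y * \<bar>f x - f y\<bar>)" by simp
  also have "\<dots> = vol E A / c * gradient A E f -
      (\<Sum>x\<in>A. \<Sum>y\<in>A. real (graph_degree E x) * real (graph_degree E y) * \<bar>f x - f y\<bar>)"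
    by (simp add: w_def gradient_def sum_subtractf sum_distrib_left left_diff_distrib mult.assoc)
  finally show ?thesis by simp
qed

end

section \<open>The lazy walk\<close>

context nontrivial_connected_graph
begin

abbreviation deg :: "'a \<Rightarrow> real" where "deg v \<equiv> real (graph_degree E v)"

lemma deg_pos: "v \<in> V \<Longrightarrow> 0 < deg v"
  using degree_ge_1[of v] by simp

text \<open>Outside \<open>B\<close>, Cheeger's inequality keeps the density \<open>f\<close> close
  to its degree-weighted mean \<open>a\<close>, and \<open>a\<close> differs from the stationary
  value \<open>1 / M\<close> only through the two masses of \<open>B\<close>. On \<open>B\<close>
  itself the difference is bounded by the sum of these masses.\<close>

lemma tv_dist_stationary_le:
  fixes \<mu> :: "'a \<Rightarrow> real"
  assumes c: "0 < c" and B: "B \<subseteq> V" "vol E B < vol E V"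
    and exp: "\<And>S. S \<subseteq> V - B \<Longrightarrow> 2 * vol E S \<le> vol E (V - B) \<Longrightarrow> c * vol E S \<le> ecount E S (V - B - S)"
    and \<mu>: "\<And>v. v \<in> V \<Longrightarrow> 0 \<le> \<mu> v" "sum \<mu> V = 1"
  shows "tv_dist V \<mu> (stationary_dist E) \<le>
    gradient V E (\<lambda>v. \<mu> v / deg v) / (2 * c) + sum \<mu> B + vol E B / vol E V"
proof -
  define A where "A = V - B"
  define f where "f v = \<mu> v / deg v" for v
  define M where "M = vol E V"
  define a where "a = sum \<mu> A / vol E A"
  have A: "A \<subseteq> V" and finA: "finite A" using finV by (auto simp: A_def)
  have finB: "finite B" using B finV finite_subset by blast
  have volA: "vol E A = M - vol E B" using vol_Diff[OF finV B(1)] by (simp add: A_def M_def)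
  then have volA_pos: "0 < vol E A" using B by (simp add: M_def)
  have Mpos: "0 < M" using vol_pos by (simp add: M_def)
  have \<mu>f: "\<mu> v = deg v * f v" if "v \<in> V" for v
    using deg_pos[OF that] by (simp add: f_def)
  have \<mu>A: "sum \<mu> A = 1 - sum \<mu> B"
    using \<mu> B finV by (simp add: A_def sum_diff)
  have \<mu>B: "0 \<le> sum \<mu> B" using \<mu> B by (intro sum_nonneg) auto
  have st: "stationary_dist E v = deg v / M" for v
    by (simp add: stationary_dist_def M_def handshake[OF simple])
  \<comment> \<open>Since \<open>a\<close> is a mean, \<open>f x - a\<close> is an average of the
    differences \<open>f x - f y\<close>.\<close>
  have "vol E A * (\<Sum>x\<in>A. deg x * \<bar>f x - a\<bar>) \<le> (\<Sum>x\<in>A. \<Sum>y\<in>A. deg x * deg y * \<bar>f x - f y\<bar>)"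
    unfolding sum_distrib_left
  proof (rule sum_mono)
    fix x assume "x \<in> A"
    have "(\<Sum>y\<in>A. deg y * (f x - f y)) = vol E A * f x - sum \<mu> A"
      using A \<mu>f by (simp add: right_diff_distrib sum_subtractf vol_def sum_distrib_right subset_iff)
    then have "vol E A * (f x - a) = (\<Sum>y\<in>A. deg y * (f x - f y))"
      using volA_pos by (simp add: a_def right_diff_distrib)
    then have "vol E A * \<bar>f x - a\<bar> = \<bar>\<Sum>y\<in>A. deg y * (f x - f y)\<bar>"
      using volA_pos by (metis abs_mult abs_of_pos)
    also have "\<dots> \<le> (\<Sum>y\<in>A. \<bar>deg y * (f x - f y)\<bar>)" by (rule sum_abs)
    also have "\<dots> = (\<Sum>y\<in>A. deg y * \<bar>f x - f y\<bar>)" by (simp add: abs_mult)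
    finally have "deg x * (vol E A * \<bar>f x - a\<bar>) \<le> deg x * (\<Sum>y\<in>A. deg y * \<bar>f x - f y\<bar>)"
      by (intro mult_left_mono) auto
    then show "vol E A * (deg x * \<bar>f x - a\<bar>) \<le> (\<Sum>y\<in>A. deg x * deg y * \<bar>f x - f y\<bar>)"
      by (simp add: sum_distrib_left mult_ac)
  qed
  also have "\<dots> \<le> vol E A / c * gradient A E f"
    using c A exp unfolding A_def by (intro cut_cheeger) auto
  also have "gradient A E f \<le> gradient V E f"
  proof -
    have "gradient A E f \<le> (\<Sum>x\<in>A. \<Sum>y\<in>V. of_bool ({x, y} \<in> E) * \<bar>f x - f y\<bar>)"
      unfolding gradient_def using A finV by (intro sum_mono sum_mono2) auto
    also have "\<dots> \<le> gradient V E f"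
      unfolding gradient_def using A finV by (intro sum_mono2 sum_nonneg) auto
    finally show ?thesis .
  qed
  finally have "vol E A * (\<Sum>x\<in>A. deg x * \<bar>f x - a\<bar>) \<le> vol E A * (gradient V E f / c)"
    using volA_pos c by (simp add: divide_right_mono)
  then have osc: "(\<Sum>x\<in>A. deg x * \<bar>f x - a\<bar>) \<le> gradient V E f / c"
    using volA_pos by (rule mult_left_le_imp_le)
  have "\<bar>\<mu> v - stationary_dist E v\<bar> \<le> deg v * \<bar>f v - a\<bar> + deg v * \<bar>a - 1 / M\<bar>" if "v \<in> A" for v
  proof -
    have "\<mu> v - stationary_dist E v = deg v * ((f v - a) + (a - 1 / M))"
      using that A \<mu>f by (auto simp: st algebra_simps)
    then have "\<bar>\<mu> v - stationary_dist E v\<bar> = deg v * \<bar>(f v - a) + (a - 1 / M)\<bar>"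
      by (simp add: abs_mult)
    also have "\<dots> \<le> deg v * (\<bar>f v - a\<bar> + \<bar>a - 1 / M\<bar>)"
      by (intro mult_left_mono abs_triangle_ineq) auto
    finally show ?thesis by (simp add: algebra_simps)
  qed
  then have "(\<Sum>v\<in>A. \<bar>\<mu> v - stationary_dist E v\<bar>) \<le> (\<Sum>v\<in>A. deg v * \<bar>f v - a\<bar> + deg v * \<bar>a - 1 / M\<bar>)"
    by (rule sum_mono)
  also have "\<dots> = (\<Sum>v\<in>A. deg v * \<bar>f v - a\<bar>) + vol E A * \<bar>a - 1 / M\<bar>"
    by (simp add: sum.distrib vol_def sum_distrib_right)
  also have "vol E A * \<bar>a - 1 / M\<bar> = \<bar>vol E A * (a - 1 / M)\<bar>"
    using volA_pos by (simp add: abs_mult)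
  \<comment> \<open>The walk and the stationary distribution both have total mass 1, so their
    discrepancy on \<open>A\<close> is the opposite of that on \<open>B\<close>.\<close>
  also have "vol E A * (a - 1 / M) = vol E B / M - sum \<mu> B"
  proof -
    have "vol E A * a = 1 - sum \<mu> B" using volA_pos \<mu>A by (simp add: a_def)
    moreover have "vol E A * (1 / M) = 1 - vol E B / M"
      using Mpos by (simp add: volA diff_divide_distrib)
    ultimately show ?thesis by (simp only: right_diff_distrib)
  qed
  also have "\<bar>vol E B / M - sum \<mu> B\<bar> \<le> vol E B / M + sum \<mu> B"
    using \<mu>B vol_nonneg[of E B] Mpos by (simp add: abs_le_iff)
  finally have onA: "(\<Sum>v\<in>A. \<bar>\<mu> v - stationary_dist E v\<bar>) \<le> gradient V E f / c + (vol E B / M + sum \<mu> B)"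
    using osc by linarith
  have "(\<Sum>v\<in>B. \<bar>\<mu> v - stationary_dist E v\<bar>) \<le> (\<Sum>v\<in>B. \<mu> v + deg v / M)"
    using B \<mu> Mpos by (intro sum_mono) (auto simp: st abs_le_iff add_increasing)
  also have "\<dots> = sum \<mu> B + vol E B / M"
    by (simp add: sum.distrib vol_def sum_divide_distrib)
  finally have "(\<Sum>v\<in>V. \<bar>\<mu> v - stationary_dist E v\<bar>) \<le> gradient V E f / c + 2 * (vol E B / M + sum \<mu> B)"
    using onA sum.subset_diff[OF B(1) finV, of "\<lambda>v. \<bar>\<mu> v - stationary_dist E v\<bar>"] by (simp add: A_def)
  then show ?thesis
    by (simp add: tv_dist_def f_def[abs_def] M_def field_simps)
qed

text \<open>This exhibits the walk as a symmetric kernel with weight 1/2 on each ordered edge and a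
  loop of weight \<open>deg x / 2\<close>, the form in which \<open>entropy_drop_ge\<close> is
  applied.\<close>

lemma lazy_kernel:
  assumes "x \<in> V" "y \<in> V"
  shows "deg x * lazy_walk_matrix E x y = (of_bool ({x, y} \<in> E) + (if x = y then deg x else 0)) / 2"
proof -
  have "{x, x} \<notin> E" using simple_graph_edgeD[OF simple] by blast
  then show ?thesis using deg_pos[OF assms(1)] by (auto simp: lazy_walk_matrix_def)
qed

lemma lazy_kernel_sym:
  "x \<in> V \<Longrightarrow> y \<in> V \<Longrightarrow> deg x * lazy_walk_matrix E x y = deg y * lazy_walk_matrix E y x"
  by (simp add: lazy_kernel insert_commute)

lemma lazy_kernel_row:
  assumes "x \<in> V" shows "(\<Sum>y\<in>V. deg x * lazy_walk_matrix E x y) = deg x"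
proof -
  have "(\<Sum>y\<in>V. deg x * lazy_walk_matrix E x y) =
      ((\<Sum>y\<in>V. of_bool ({x, y} \<in> E)) + (\<Sum>y\<in>V. if x = y then deg x else 0)) / 2"
    using assms by (simp only: lazy_kernel sum.distrib flip: sum_divide_distrib cong: sum.cong)
  also have "(\<Sum>y\<in>V. of_bool ({x, y} \<in> E)) = deg x"
    using graph_degree_eq_sum[OF simple assms] by (rule sym)
  also have "(\<Sum>y\<in>V. if x = y then deg x else 0) = deg x"
    using assms finV by simp
  finally show ?thesis by simp
qed

lemma lazy_walk_row: "x \<in> V \<Longrightarrow> (\<Sum>y\<in>V. lazy_walk_matrix E x y) = 1"
  using lazy_kernel_row[of x] deg_pos[of x] by (simp flip: sum_distrib_left)

lemma walk_dist_0: "walk_dist V E u 0 = point_mass u"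
  by (simp add: walk_dist_def)

lemma walk_dist_Suc: "walk_dist V E u (Suc t) v = (\<Sum>w\<in>V. walk_dist V E u t w * lazy_walk_matrix E w v)"
  by (simp add: walk_dist_def row_mult_def)

lemma walk_dist_nonneg: "0 \<le> walk_dist V E u t v"
  by (induction t arbitrary: v)
    (auto simp: walk_dist_0 walk_dist_Suc point_mass_def lazy_walk_matrix_def intro!: sum_nonneg mult_nonneg_nonneg)

lemma sum_walk_dist:
  assumes "u \<in> V" shows "(\<Sum>v\<in>V. walk_dist V E u t v) = 1"
proof (induction t)
  case 0
  show ?case using assms finV by (simp add: walk_dist_0 point_mass_def)
next
  case (Suc t)
  have "(\<Sum>v\<in>V. walk_dist V E u (Suc t) v) = (\<Sum>w\<in>V. walk_dist V E u t w * (\<Sum>v\<in>V. lazy_walk_matrix E w v))"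
    unfolding walk_dist_Suc by (subst sum.swap) (simp add: sum_distrib_left)
  then show ?case using Suc by (simp add: lazy_walk_row)
qed

text \<open>The degrees form an invariant measure that dominates counting measure.\<close>

lemma sum_walk_dist_start_le:
  assumes "v \<in> V" shows "(\<Sum>u\<in>V. walk_dist V E u t v) \<le> deg v"
  using assms
proof (induction t arbitrary: v)
  case 0
  then show ?case using finV degree_ge_1[of v] by (simp add: walk_dist_0 point_mass_def)
next
  case (Suc t)
  have "(\<Sum>u\<in>V. walk_dist V E u (Suc t) v) =
      (\<Sum>w\<in>V. (\<Sum>u\<in>V. walk_dist V E u t w) * lazy_walk_matrix E w v)"
    unfolding walk_dist_Suc by (subst sum.swap) (simp add: sum_distrib_right)
  also have "\<dots> \<le> (\<Sum>w\<in>V. deg w * lazy_walk_matrix E w v)"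
    using Suc.IH by (intro sum_mono mult_right_mono) (auto simp: lazy_walk_matrix_def)
  also have "\<dots> = (\<Sum>w\<in>V. deg v * lazy_walk_matrix E v w)"
    using Suc.prems by (intro sum.cong refl lazy_kernel_sym) auto
  also have "\<dots> = deg v" using Suc.prems by (rule lazy_kernel_row)
  finally show ?case .
qed

section \<open>Densities and entropy along the walk\<close>

definition density :: "'a \<Rightarrow> nat \<Rightarrow> 'a \<Rightarrow> real" where
  "density u t v = walk_dist V E u t v / deg v"

text \<open>The reference measure is the degree measure without normalisation; the relative entropy
  with respect to the stationary distribution is larger by \<open>ln (vol E V)\<close>. Along the
  walk the value stays between \<open>- ln (vol E V)\<close> and 0.\<close>

definition entropy :: "('a \<Rightarrow> real) \<Rightarrow> real" where
  "entropy f = (\<Sum>v\<in>V. deg v * (f v * ln (f v)))"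

lemma density_nonneg: "0 \<le> density u t v"
  by (simp add: density_def walk_dist_nonneg)

lemma deg_density: "v \<in> V \<Longrightarrow> deg v * density u t v = walk_dist V E u t v"
  using deg_pos[of v] by (simp add: density_def)

text \<open>By reversibility densities evolve by the transition matrix itself instead of its
  transpose; this is the averaging hypothesis of \<open>entropy_drop_ge\<close>.\<close>

lemma deg_density_Suc:
  assumes "x \<in> V"
  shows "deg x * density u (Suc t) x = (\<Sum>y\<in>V. deg x * lazy_walk_matrix E x y * density u t y)"
proof -
  have "deg x * density u (Suc t) x = (\<Sum>y\<in>V. (deg y * density u t y) * lazy_walk_matrix E y x)"
    using assms by (simp add: deg_density walk_dist_Suc)
  also have "\<dots> = (\<Sum>y\<in>V. (deg y * lazy_walk_matrix E y x) * density u t y)"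
    by (simp add: mult_ac)
  also have "\<dots> = (\<Sum>y\<in>V. (deg x * lazy_walk_matrix E x y) * density u t y)"
    using assms by (intro sum.cong refl) (simp add: lazy_kernel_sym)
  finally show ?thesis .
qed

text \<open>The entropy drop controls the differences between the old density at \<open>y\<close>
  and the new density at \<open>x\<close>. Laziness includes the pair \<open>x = y\<close>, so the
  triangle inequality through the new value at \<open>x\<close> controls the old density along
  edges. The edge weight 1/2 turns the factor 4 into 16.\<close>

lemma gradient_le_entropy_drop:
  assumes "u \<in> V"
  shows "(gradient V E (density u t))\<^sup>2 \<le> 16 * (entropy (density u t) - entropy (density u (Suc t)))"
proof -
  let ?q = "\<lambda>x y. deg x * lazy_walk_matrix E x y" and ?f = "density u t" and ?g = "density u (Suc t)"
  have "(\<Sum>x\<in>V. deg x * ?f x) = 1"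
    using sum_walk_dist[OF assms] by (simp add: deg_density)
  moreover have "(\<Sum>x\<in>V. \<Sum>y\<in>V. ?q x y * \<bar>?f y - ?g x\<bar>)\<^sup>2 \<le>
      4 * (\<Sum>x\<in>V. deg x * ?f x) * ((\<Sum>x\<in>V. deg x * (?f x * ln (?f x))) - (\<Sum>x\<in>V. deg x * (?g x * ln (?g x))))"
    using finV lazy_kernel_sym lazy_kernel_row deg_pos density_nonneg deg_density_Suc
    by (intro entropy_drop_ge) (auto simp: lazy_walk_matrix_def)
  ultimately have drop: "(\<Sum>x\<in>V. \<Sum>y\<in>V. ?q x y * \<bar>?f y - ?g x\<bar>)\<^sup>2 \<le> 4 * (entropy ?f - entropy ?g)"
    by (simp add: entropy_def)
  have "gradient V E ?f / 2 = (\<Sum>x\<in>V. \<Sum>y\<in>V. of_bool ({x, y} \<in> E) * \<bar>?f x - ?f y\<bar> / 2)"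
    by (simp only: gradient_def sum_divide_distrib)
  also have "\<dots> \<le> (\<Sum>x\<in>V. \<Sum>y\<in>V. ?q x y * \<bar>?f y - ?g x\<bar>)"
  proof (rule sum_mono)
    fix x assume x: "x \<in> V"
    \<comment> \<open>Summed over the edges at \<open>x\<close>, the second part of the triangle
      inequality becomes exactly the loop term of the kernel.\<close>
    have "(\<Sum>y\<in>V. of_bool ({x, y} \<in> E) * \<bar>?f x - ?f y\<bar> / 2) \<le>
        (\<Sum>y\<in>V. of_bool ({x, y} \<in> E) * \<bar>?f y - ?g x\<bar> / 2 + of_bool ({x, y} \<in> E) * (\<bar>?f x - ?g x\<bar> / 2))"
      by (intro sum_mono) auto
    also have "\<dots> = (\<Sum>y\<in>V. of_bool ({x, y} \<in> E) * \<bar>?f y - ?g x\<bar> / 2) + deg x * (\<bar>?f x - ?g x\<bar> / 2)"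
      by (simp only: sum.distrib graph_degree_eq_sum[OF simple x] sum_distrib_right)
    also have "deg x * (\<bar>?f x - ?g x\<bar> / 2) = (\<Sum>y\<in>V. (if x = y then deg x else 0) * \<bar>?f y - ?g x\<bar> / 2)"
      using x finV by (simp add: if_distrib[of "\<lambda>z. z * _"] if_distrib[of "\<lambda>z. z / _"] cong: if_cong)
    also have "(\<Sum>y\<in>V. of_bool ({x, y} \<in> E) * \<bar>?f y - ?g x\<bar> / 2) + \<dots> = (\<Sum>y\<in>V. ?q x y * \<bar>?f y - ?g x\<bar>)"
      unfolding sum.distrib[symmetric] using x
      by (intro sum.cong refl) (simp only: lazy_kernel, simp add: algebra_simps add_divide_distrib)
    finally show "(\<Sum>y\<in>V. of_bool ({x, y} \<in> E) * \<bar>?f x - ?f y\<bar> / 2) \<le> (\<Sum>y\<in>V. ?q x y * \<bar>?f y - ?g x\<bar>)" .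
  qed
  finally have "(gradient V E ?f / 2)\<^sup>2 \<le> (\<Sum>x\<in>V. \<Sum>y\<in>V. ?q x y * \<bar>?f y - ?g x\<bar>)\<^sup>2"
    by (intro power_mono) (auto simp: gradient_nonneg)
  with drop show ?thesis by (simp add: power_divide)
qed

lemma entropy_start:
  assumes "u \<in> V" shows "entropy (density u 0) \<le> 0"
proof -
  have "entropy (density u 0) = (\<Sum>v\<in>V. if v = u then ln (1 / deg u) else 0)"
    unfolding entropy_def using deg_pos[OF assms]
    by (intro sum.cong refl) (auto simp: density_def walk_dist_0 point_mass_def)
  also have "\<dots> = ln (1 / deg u)" using assms finV by simp
  also have "\<dots> \<le> 0" using degree_ge_1[OF assms] by (simp add: ln_div)
  finally show ?thesis .
qed

lemma entropy_ge:
  assumes "u \<in> V" shows "- ln (vol E V) \<le> entropy (density u t)"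
proof -
  let ?M = "vol E V" and ?f = "density u t"
  have "(\<Sum>v\<in>V. deg v * (?f v * ln (1 / ?M) + ?f v - 1 / ?M)) \<le> entropy ?f"
    unfolding entropy_def using vol_pos density_nonneg
    by (intro sum_mono mult_left_mono relative_entropy_nonneg) auto
  also have "(\<Sum>v\<in>V. deg v * (?f v * ln (1 / ?M) + ?f v - 1 / ?M)) =
      (\<Sum>v\<in>V. (deg v * ?f v) * (ln (1 / ?M) + 1)) - (\<Sum>v\<in>V. deg v / ?M)"
    unfolding sum_subtractf[symmetric] by (intro sum.cong refl) (simp add: algebra_simps)
  also have "(\<Sum>v\<in>V. deg v / ?M) = 1"
    using vol_pos by (simp add: vol_def flip: sum_divide_distrib)
  also have "(\<Sum>v\<in>V. (deg v * ?f v) * (ln (1 / ?M) + 1)) = ln (1 / ?M) + 1"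
    using sum_walk_dist[OF assms, of t] by (simp add: deg_density flip: sum_distrib_right)
  finally show ?thesis using vol_pos by (simp add: ln_div)
qed

text \<open>Averaging over starting vertices enters twice. The drops summed over all starts
  telescope, so one time \<open>t\<close> serves all starts together; and the walk's mass in
  \<open>B\<close>, possibly large for a single start, sums to at most
  \<open>vol E B\<close>.\<close>

lemma exists_time_avg_tv_le:
  assumes c: "0 < c" and B: "B \<subseteq> V" "vol E B < vol E V"
    and exp: "\<And>S. S \<subseteq> V - B \<Longrightarrow> 2 * vol E S \<le> vol E (V - B) \<Longrightarrow> c * vol E S \<le> ecount E S (V - B - S)"
    and T: "0 < T"
  shows "\<exists>t<T. 1 / real (card V) * (\<Sum>u\<in>V. tv_dist V (walk_dist V E u t) (stationary_dist E)) \<le>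
    2 * sqrt (ln (vol E V) / real T) / c + 2 * vol E B / real (card V)"
proof -
  define n where "n = real (card V)"
  define drop where "drop t = (\<Sum>u\<in>V. entropy (density u t) - entropy (density u (Suc t)))" for t
  have n: "0 < n" using card_ge_2 by (simp add: n_def)
  have "(\<Sum>t<T. drop t) = (\<Sum>u\<in>V. \<Sum>t<T. entropy (density u t) - entropy (density u (Suc t)))"
    unfolding drop_def by (rule sum.swap)
  also have "\<dots> = (\<Sum>u\<in>V. entropy (density u 0) - entropy (density u T))"
    by (intro sum.cong refl sum_lessThan_telescope'[of "\<lambda>t. entropy (density _ t)"])
  also have "\<dots> \<le> (\<Sum>u\<in>V. ln (vol E V))"
    using entropy_start entropy_ge[of _ T] by (intro sum_mono) force
  also have "\<dots> = n * ln (vol E V)" by (simp add: n_def)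
  finally have total: "(\<Sum>t<T. drop t) \<le> n * ln (vol E V)" .
  have "\<exists>t<T. drop t \<le> n * ln (vol E V) / real T"
  proof (rule ccontr)
    assume "\<not> ?thesis"
    then have "(\<Sum>t<T. n * ln (vol E V) / real T) < (\<Sum>t<T. drop t)"
      using T by (intro sum_strict_mono) auto
    then show False using total T by simp
  qed
  then obtain t where t: "t < T" "drop t \<le> n * ln (vol E V) / real T" by blast
  let ?g = "\<lambda>u. gradient V E (density u t)"
  \<comment> \<open>Only the sum of the drops over all starts is small at time \<open>t\<close>,
    hence Cauchy-Schwarz over \<open>u\<close>.\<close>
  have "(\<Sum>u\<in>V. ?g u)\<^sup>2 \<le> n * (\<Sum>u\<in>V. (?g u)\<^sup>2)"
    using Cauchy_Schwarz_ineq_sum[of "\<lambda>_. 1" ?g V] by (simp add: n_def)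
  also have "\<dots> \<le> n * (\<Sum>u\<in>V. 16 * (entropy (density u t) - entropy (density u (Suc t))))"
    using n by (intro mult_left_mono sum_mono gradient_le_entropy_drop) auto
  also have "\<dots> = n * (16 * drop t)" by (simp add: drop_def sum_distrib_left)
  also have "\<dots> \<le> n * (16 * (n * ln (vol E V) / real T))"
    using n t by (intro mult_left_mono) auto
  also have "\<dots> = (4 * n)\<^sup>2 * (ln (vol E V) / real T)" by (simp add: power2_eq_square)
  finally have "sqrt ((\<Sum>u\<in>V. ?g u)\<^sup>2) \<le> sqrt ((4 * n)\<^sup>2 * (ln (vol E V) / real T))"
    by (rule real_sqrt_le_mono)
  moreover have "sqrt ((4 * n)\<^sup>2 * (ln (vol E V) / real T)) = 4 * n * sqrt (ln (vol E V) / real T)"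
    using n by (simp only: real_sqrt_mult real_sqrt_abs)
  ultimately have grad: "(\<Sum>u\<in>V. ?g u) \<le> 4 * n * sqrt (ln (vol E V) / real T)"
    by (simp only: real_sqrt_abs)
  have "(\<Sum>u\<in>V. tv_dist V (walk_dist V E u t) (stationary_dist E)) \<le>
      (\<Sum>u\<in>V. ?g u / (2 * c) + sum (walk_dist V E u t) B + vol E B / vol E V)"
  proof (rule sum_mono)
    fix u assume "u \<in> V"
    show "tv_dist V (walk_dist V E u t) (stationary_dist E) \<le>
        ?g u / (2 * c) + sum (walk_dist V E u t) B + vol E B / vol E V"
      using tv_dist_stationary_le[OF c B exp walk_dist_nonneg sum_walk_dist[OF \<open>u \<in> V\<close>], of t]
      by (simp add: density_def[abs_def])
  qed
  also have "\<dots> = (\<Sum>u\<in>V. ?g u) / (2 * c) + (\<Sum>v\<in>B. \<Sum>u\<in>V. walk_dist V E u t v) + n * (vol E B / vol E V)"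
    by (simp add: sum.distrib n_def sum.swap[of _ B] flip: sum_divide_distrib)
  \<comment> \<open>The last two terms are the walk mass and the stationary mass of
    \<open>B\<close>, summed over all starts; the second is at most \<open>vol E B\<close> because
    \<open>n \<le> vol E V\<close>.\<close>
  also have "\<dots> \<le> 4 * n * sqrt (ln (vol E V) / real T) / (2 * c) + vol E B + vol E B"
  proof (intro add_mono)
    show "(\<Sum>u\<in>V. ?g u) / (2 * c) \<le> 4 * n * sqrt (ln (vol E V) / real T) / (2 * c)"
      using grad c by (intro divide_right_mono) auto
    show "(\<Sum>v\<in>B. \<Sum>u\<in>V. walk_dist V E u t v) \<le> vol E B"
      unfolding vol_def using B by (intro sum_mono sum_walk_dist_start_le) auto
    have "n * vol E B \<le> vol E V * vol E B"
      using card_le_vol[of V] by (intro mult_right_mono) (auto simp: n_def vol_nonneg)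
    then show "n * (vol E B / vol E V) \<le> vol E B"
      using vol_pos by (simp add: field_simps)
  qed
  finally have "1 / n * (\<Sum>u\<in>V. tv_dist V (walk_dist V E u t) (stationary_dist E)) \<le>
      1 / n * (4 * n * sqrt (ln (vol E V) / real T) / (2 * c) + vol E B + vol E B)"
    using n by (intro mult_left_mono) auto
  also have "\<dots> = 2 * sqrt (ln (vol E V) / real T) / c + 2 * vol E B / n"
    using n c by (simp add: field_simps)
  finally show ?thesis using t by (auto simp: n_def)
qed

end

section \<open>Binomial random graphs\<close>

text \<open>The exponential moment factorises over the independent edges; those outside
  \<open>F\<close> contribute 1, the others \<open>1 + p * (exp l - 1)\<close>.\<close>

lemma expectation_exp_card_le:
  fixes l p :: real
  assumes "finite A" "F \<subseteq> A" "0 \<le> p" "p \<le> 1"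
  shows "measure_pmf.expectation (Pi_pmf A False (\<lambda>_. bernoulli_pmf p)) (\<lambda>f. exp (l * real (card {e \<in> F. f e})))
    \<le> exp (p * (exp l - 1) * real (card F))"
proof -
  let ?h = "\<lambda>e b. if e \<in> F \<and> b then exp l else 1"
  have finF: "finite F" using assms finite_subset by blast
  have eq: "exp (l * real (card {e \<in> F. f e})) = (\<Prod>e\<in>A. ?h e (f e))" for f
  proof -
    have "(\<Prod>e\<in>A. ?h e (f e)) = (\<Prod>e\<in>{e \<in> F. f e}. exp l)"
      using assms by (intro prod.mono_neutral_cong_right) auto
    then show ?thesis by (simp add: exp_of_nat2_mult)
  qed
  have "measure_pmf.expectation (Pi_pmf A False (\<lambda>_. bernoulli_pmf p)) (\<lambda>f. \<Prod>e\<in>A. ?h e (f e)) =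
      (\<Prod>e\<in>A. measure_pmf.expectation (bernoulli_pmf p) (?h e))"
    using assms by (intro expectation_prod_Pi_pmf integrable_measure_pmf_finite) auto
  also have "\<dots> = (\<Prod>e\<in>A. if e \<in> F then 1 + p * (exp l - 1) else 1)"
    using assms by (intro prod.cong refl) (auto simp: algebra_simps)
  also have "\<dots> = (1 + p * (exp l - 1)) ^ card F"
    using assms finF by (simp add: prod.If_cases Int_absorb1)
  also have "\<dots> \<le> exp (p * (exp l - 1)) ^ card F"
  proof (rule power_mono)
    show "0 \<le> 1 + p * (exp l - 1)"
    proof -
      have "0 \<le> (1 - p) + p * exp l" using assms by (intro add_nonneg_nonneg) auto
      then show ?thesis by (simp add: algebra_simps)
    qed
  qed (rule exp_ge_add_one_self)
  also have "\<dots> = exp (p * (exp l - 1) * real (card F))"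
    by (simp add: exp_of_nat_mult mult.commute)
  finally show ?thesis by (simp add: eq)
qed

text \<open>Markov's inequality for the exponential moment. The event is phrased with
  \<open>l\<close> inside, so that positive \<open>l\<close> gives upper tails and negative
  \<open>l\<close> lower tails.\<close>

lemma prob_exp_card_ge_le:
  fixes l p a :: real
  assumes "finite A" "F \<subseteq> A" "0 \<le> p" "p \<le> 1"
  shows "measure_pmf.prob (Pi_pmf A False (\<lambda>_. bernoulli_pmf p)) {f. a \<le> l * real (card {e \<in> F. f e})}
    \<le> exp (p * (exp l - 1) * real (card F) - a)"
proof -
  let ?M = "Pi_pmf A False (\<lambda>_. bernoulli_pmf p)"
  have "finite (set_pmf ?M)"
    using assms(1) by (simp add: set_Pi_pmf finite_PiE_dflt)
  then have "measure_pmf.prob ?M {f \<in> space ?M. exp a \<le> exp (l * real (card {e \<in> F. f e}))} \<le>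
      measure_pmf.expectation ?M (\<lambda>f. exp (l * real (card {e \<in> F. f e}))) / exp a"
    by (intro integral_Markov_inequality_measure[where A = UNIV] integrable_measure_pmf_finite) auto
  also have "\<dots> \<le> exp (p * (exp l - 1) * real (card F)) / exp a"
    using assms by (intro divide_right_mono expectation_exp_card_le) auto
  finally show ?thesis by (simp add: exp_diff)
qed

lemma prob_gnp:
  "measure_pmf.prob (gnp n p) {R. Q R} =
    measure_pmf.prob (Pi_pmf (nsets {1..n} 2) False (\<lambda>_. bernoulli_pmf p)) {f. Q {e \<in> nsets {1..n} 2. f e}}"
  by (simp add: gnp_def vimage_def)

lemma gnp_subset: "R \<in> set_pmf (gnp n p) \<Longrightarrow> R \<subseteq> nsets {1..n} 2"
  by (auto simp: gnp_def)

text \<open>The case \<open>l = 1\<close>, with \<open>exp 1 \<le> 3\<close>.\<close>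

lemma gnp_upper_tail:
  assumes "F \<subseteq> nsets {1..n} 2" "0 \<le> p" "p \<le> 1"
  shows "measure_pmf.prob (gnp n p) {R. a \<le> real (card (R \<inter> F))} \<le> exp (2 * p * real (card F) - a)"
proof -
  have "{e \<in> nsets {1..n} 2. f e} \<inter> F = {e \<in> F. f e}" for f using assms(1) by auto
  then have "measure_pmf.prob (gnp n p) {R. a \<le> real (card (R \<inter> F))} \<le> exp (p * (exp 1 - 1) * real (card F) - a)"
    using prob_exp_card_ge_le[OF finite_imp_finite_nsets[OF finite_atLeastAtMost] assms, of a 1]
    by (simp add: prob_gnp)
  also have "p * (exp 1 - 1) * real (card F) \<le> p * 2 * real (card F)"
    using exp_le assms by (intro mult_right_mono mult_left_mono) auto
  finally show ?thesis by (simp add: mult_ac)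
qed

text \<open>The case \<open>l = -1\<close>, with \<open>exp (-1) \<le> 1 / 2\<close>.\<close>

lemma gnp_lower_tail:
  assumes "F \<subseteq> nsets {1..n} 2" "0 \<le> p" "p \<le> 1"
  shows "measure_pmf.prob (gnp n p) {R. real (card (R \<inter> F)) \<le> a} \<le> exp (a - p * real (card F) / 2)"
proof -
  have "{e \<in> nsets {1..n} 2. f e} \<inter> F = {e \<in> F. f e}" for f using assms(1) by auto
  then have "measure_pmf.prob (gnp n p) {R. real (card (R \<inter> F)) \<le> a} \<le> exp (p * (exp (-1) - 1) * real (card F) + a)"
    using prob_exp_card_ge_le[OF finite_imp_finite_nsets[OF finite_atLeastAtMost] assms, of "-a" "-1"]
    by (simp add: prob_gnp)
  also have "p * (exp (-1) - 1) * real (card F) \<le> p * (- 1 / 2) * real (card F)"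
  proof -
    have "2 \<le> exp (1 :: real)" using exp_ge_add_one_self[of "1 :: real"] by simp
    then have "exp (- 1 :: real) \<le> 1 / 2" by (simp add: exp_minus field_simps)
    then show ?thesis using assms by (intro mult_right_mono mult_left_mono) auto
  qed
  finally show ?thesis by simp
qed

lemma measure_pmf_UN_le:
  assumes "finite I" "\<And>i. i \<in> I \<Longrightarrow> measure_pmf.prob M {x. P i x} \<le> b"
  shows "measure_pmf.prob M {x. \<exists>i\<in>I. P i x} \<le> real (card I) * b"
proof -
  have "measure_pmf.prob M {x. \<exists>i\<in>I. P i x} = measure_pmf.prob M (\<Union>i\<in>I. {x. P i x})"
    by (intro arg_cong[of _ _ "measure_pmf.prob M"]) auto
  also have "\<dots> \<le> (\<Sum>i\<in>I. measure_pmf.prob M {x. P i x})"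
    using assms(1) by (intro measure_pmf.finite_measure_subadditive_finite) auto
  also have "\<dots> \<le> (\<Sum>i\<in>I. b)" using assms(2) by (rule sum_mono)
  finally show ?thesis by simp
qed

section \<open>Counting small vertex sets\<close>

text \<open>Weight every subset by \<open>y ^ card S\<close>; the total weight is \<open>(1 + y) ^ card V\<close>.\<close>

lemma card_small_subsets_le:
  fixes y k :: real
  assumes "finite V" "0 < y" "y \<le> 1"
  shows "real (card {S. S \<subseteq> V \<and> real (card S) \<le> k}) \<le> exp (y * real (card V) + k * ln (1 / y))"
proof -
  let ?F = "{S. S \<subseteq> V \<and> real (card S) \<le> k}"
  have fin: "finite ?F" using assms(1) by simp
  have "real (card ?F) * exp (- k * ln (1 / y)) = (\<Sum>S\<in>?F. exp (- k * ln (1 / y)))"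
    by simp
  also have "\<dots> \<le> (\<Sum>S\<in>?F. y ^ card S)"
  proof (rule sum_mono)
    fix S assume "S \<in> ?F"
    then have "k * ln y \<le> real (card S) * ln y"
      using assms by (intro mult_right_mono_neg) auto
    then have "exp (k * ln y) \<le> exp (real (card S) * ln y)" by simp
    also have "\<dots> = y ^ card S" using assms by (simp add: exp_of_nat_mult)
    finally show "exp (- k * ln (1 / y)) \<le> y ^ card S" using assms by (simp add: ln_div)
  qed
  also have "\<dots> \<le> (\<Sum>S\<in>Pow V. y ^ card S)"
    using assms by (intro sum_mono2) auto
  also have "\<dots> = (\<Sum>S\<in>Pow V. (\<Prod>v\<in>S. y) * (\<Prod>v\<in>V - S. 1))" by simp
  also have "\<dots> = (\<Prod>v\<in>V. y + 1)" by (rule prod_add[OF assms(1), symmetric])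
  also have "\<dots> = (1 + y) ^ card V" by (simp add: add.commute)
  also have "\<dots> \<le> exp y ^ card V" using assms by (intro power_mono exp_ge_add_one_self) auto
  also have "\<dots> = exp (y * real (card V))" by (simp add: exp_of_nat2_mult)
  finally show ?thesis by (simp add: exp_add exp_minus field_simps)
qed

lemma card_small_subsets_exp_rate:
  fixes a :: real
  assumes "0 < a"
  obtains \<gamma> where "0 < \<gamma>"
    "\<And>V :: 'a set. finite V \<Longrightarrow> real (card {S. S \<subseteq> V \<and> real (card S) \<le> \<gamma> * real (card V)}) \<le> exp (a * real (card V))"
proof -
  \<comment> \<open>Each of the two terms in the exponent of \<open>card_small_subsets_le\<close>
    gets the budget \<open>a / 2\<close>. The summand 1 in the denominator of
    \<open>\<gamma>\<close> covers \<open>y = 1\<close>, where the logarithm vanishes.\<close>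
  define y where "y = min 1 (a / 2)"
  define \<gamma> where "\<gamma> = a / (2 * (1 + ln (1 / y)))"
  have y: "0 < y" "y \<le> 1" "y \<le> a / 2" using assms by (auto simp: y_def)
  have l: "0 \<le> ln (1 / y)" using y by simp
  show thesis
  proof (rule that)
    show "0 < \<gamma>" using assms l by (simp add: \<gamma>_def)
    fix V :: "'a set" assume V: "finite V"
    have "\<gamma> * ln (1 / y) \<le> \<gamma> * (1 + ln (1 / y))"
      using assms l by (intro mult_left_mono) (auto simp: \<gamma>_def)
    also have "\<dots> = a / 2" using l by (simp add: \<gamma>_def field_simps)
    finally have "y + \<gamma> * ln (1 / y) \<le> a" using y by simp
    then have "(y + \<gamma> * ln (1 / y)) * real (card V) \<le> a * real (card V)"
      by (rule mult_right_mono) simp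
    then have "exp (y * real (card V) + \<gamma> * real (card V) * ln (1 / y)) \<le> exp (a * real (card V))"
      by (simp add: algebra_simps)
    with card_small_subsets_le[OF V y(1,2), of "\<gamma> * real (card V)"]
    show "real (card {S. S \<subseteq> V \<and> real (card S) \<le> \<gamma> * real (card V)}) \<le> exp (a * real (card V))"
      by linarith
  qed
qed

section \<open>Cuts of connected and degenerate graphs\<close>

lemma ecount_eq_card:
  assumes "finite S" "finite T"
  shows "ecount E S T = real (card {(x, y). x \<in> S \<and> y \<in> T \<and> {x, y} \<in> E})"
proof -
  have "ecount E S T = (\<Sum>z\<in>S \<times> T. of_bool ({fst z, snd z} \<in> E))"
    by (simp only: ecount_def sum.cartesian_product) (simp only: case_prod_unfold)
  also have "\<dots> = real (card ((S \<times> T) \<inter> {z. {fst z, snd z} \<in> E}))"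
    using assms by (simp add: of_bool_def sum.If_cases)
  also have "(S \<times> T) \<inter> {z. {fst z, snd z} \<in> E} = {(x, y). x \<in> S \<and> y \<in> T \<and> {x, y} \<in> E}"
    by auto
  finally show ?thesis .
qed

lemma ecount_mono: "E \<subseteq> E' \<Longrightarrow> ecount E S T \<le> ecount E' S T"
  unfolding ecount_def by (intro sum_mono) auto

lemma ecount_Un_le: "ecount (E \<union> E') S T \<le> ecount E S T + ecount E' S T"
  unfolding ecount_def sum.distrib[symmetric] by (intro sum_mono) auto

lemma ecount_inside:
  assumes "finite S" and "E \<subseteq> nsets V 2"
  shows "ecount E S S = 2 * real (card (E \<inter> nsets S 2))"
proof -
  have sg: "simple_graph S (E \<inter> nsets S 2)" using assms by (simp add: simple_graph_def)
  have "({x, y} \<in> E) = ({x, y} \<in> E \<inter> nsets S 2)" if "x \<in> S" "y \<in> S" for x y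
    using assms(2) that by (auto dest!: subsetD simp: nsets_def card_2_iff)
  then have "ecount E S S = ecount (E \<inter> nsets S 2) S S"
    unfolding ecount_def by (intro sum.cong refl) simp
  also have "\<dots> = 2 * real (card (E \<inter> nsets S 2))"
    using vol_eq_ecount[OF sg order_refl] handshake[OF sg] by simp
  finally show ?thesis .
qed

text \<open>For disjoint sets ordered pairs correspond to distinct potential edges, so a cut becomes
  a count of random edges to which the tail bounds apply.\<close>

lemma ecount_cross:
  fixes S T :: "'a set"
  assumes "finite S" "finite T" "S \<inter> T = {}"
  defines "F \<equiv> (\<lambda>(x, y). {x, y}) ` (S \<times> T)"
  shows "ecount E S T = real (card (E \<inter> F))" and "card F = card S * card T"
proof -
  have inj: "inj_on (\<lambda>(x, y). {x, y}) (S \<times> T)"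
    using assms(3) by (auto simp: inj_on_def doubleton_eq_iff)
  then show "card F = card S * card T"
    unfolding F_def by (simp add: card_image card_cartesian_product)
  have "E \<inter> F = (\<lambda>(x, y). {x, y}) ` {(x, y). x \<in> S \<and> y \<in> T \<and> {x, y} \<in> E}"
    by (auto simp: F_def)
  moreover have "inj_on (\<lambda>(x, y). {x, y}) {(x, y). x \<in> S \<and> y \<in> T \<and> {x, y} \<in> E}"
    using inj by (rule inj_on_subset) auto
  ultimately have "card (E \<inter> F) = card {(x, y). x \<in> S \<and> y \<in> T \<and> {x, y} \<in> E}"
    by (simp only: card_image)
  then show "ecount E S T = real (card (E \<inter> F))"
    using assms by (simp add: ecount_eq_card)
qed

text \<open>Charge every edge inside \<open>S\<close> to its later endpoint in the degeneracy order:
  each vertex is charged at most \<open>d\<close> times, and ordered pairs give the factor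
  2.\<close>

lemma degenerate_ecount_le:
  assumes sg: "simple_graph V E" and deg: "degenerate d V E" and S: "S \<subseteq> V"
  shows "ecount E S S \<le> 2 * real d * real (card S)"
proof -
  obtain xs where xs: "set xs = V" "distinct xs"
    and preceding: "\<And>i. i < length xs \<Longrightarrow> card {j. j < i \<and> {xs ! j, xs ! i} \<in> E} \<le> d"
    using deg by (auto simp: degenerate_def permutations_of_set_def)
  define pos where "pos = inv_into {..<length xs} ((!) xs)"
  have bij: "bij_betw ((!) xs) {..<length xs} V"
    using xs by (intro bij_betw_nth) auto
  have pos: "pos x < length xs" "xs ! pos x = x" if "x \<in> V" for x
    using bij_betw_inv_into_right[OF bij that] bij_betw_apply[OF bij_betw_inv_into[OF bij] that]
    by (auto simp: pos_def)
  have finS: "finite S" using S simple_graph_finite[OF sg] finite_subset by blast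
  have preceding': "(\<Sum>x\<in>S. of_bool ({x, y} \<in> E \<and> pos x < pos y)) \<le> real d" if y: "y \<in> S" for y
  proof -
    have yV: "y \<in> V" using y S by auto
    let ?X = "{x \<in> S. {x, y} \<in> E \<and> pos x < pos y}"
    have "card ?X \<le> card {j. j < pos y \<and> {xs ! j, xs ! pos y} \<in> E}"
    proof (rule card_inj_on_le)
      show "inj_on pos ?X" using pos S by (intro inj_onI) (metis (no_types, lifting) mem_Collect_eq subsetD)
      show "pos ` ?X \<subseteq> {j. j < pos y \<and> {xs ! j, xs ! pos y} \<in> E}" using pos S yV by auto
    qed simp
    also have "\<dots> \<le> d" by (rule preceding) (rule pos(1)[OF yV])
    finally have "real (card ?X) \<le> real d" by simp
    moreover have "(\<Sum>x\<in>S. of_bool ({x, y} \<in> E \<and> pos x < pos y)) = real (card ?X)"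
      using finS by (simp add: of_bool_def sum.If_cases Int_def)
    ultimately show ?thesis by simp
  qed
  have neq: "pos x \<noteq> pos y" if "x \<in> S" "y \<in> S" "{x, y} \<in> E" for x y
    using simple_graph_edgeD[OF sg that(3)] pos by metis
  have "ecount E S S = (\<Sum>y\<in>S. \<Sum>x\<in>S. of_bool ({x, y} \<in> E))"
    unfolding ecount_def by (simp only: insert_commute)
  also have "\<dots> \<le> (\<Sum>y\<in>S. \<Sum>x\<in>S. of_bool ({x, y} \<in> E \<and> pos x < pos y) + of_bool ({y, x} \<in> E \<and> pos y < pos x))"
  proof (intro sum_mono)
    fix x y assume "x \<in> S" "y \<in> S"
    then show "of_bool ({x, y} \<in> E) \<le> (of_bool ({x, y} \<in> E \<and> pos x < pos y) + of_bool ({y, x} \<in> E \<and> pos y < pos x) :: real)"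
      using neq[of x y] by (cases "{x, y} \<in> E") (auto simp: insert_commute[of y])
  qed
  also have "\<dots> = 2 * (\<Sum>y\<in>S. \<Sum>x\<in>S. of_bool ({x, y} \<in> E \<and> pos x < pos y))"
    using sum.swap[of "\<lambda>x y. of_bool ({x, y} \<in> E \<and> pos x < pos y) :: real" S S]
    by (simp only: sum.distrib)
  also have "\<dots> \<le> 2 * (\<Sum>y\<in>S. real d)"
    using preceding' by (intro mult_left_mono sum_mono) auto
  finally show ?thesis by (simp add: mult_ac)
qed

text \<open>
  Choosing for every vertex but the root \<open>r\<close> a neighbour \<open>p v\<close> closer to \<open>r\<close>, a set \<open>S\<close> is determined
  by whether it contains \<open>r\<close> and by which of the edges \<open>{v, p v}\<close> it cuts.
\<close>

lemma card_small_cuts_le: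
  assumes conn: "connected_graph V E"
  shows "card {S. S \<subseteq> V \<and> ecount E S (V - S) \<le> k} \<le> card {D. D \<subseteq> V \<and> real (card D) \<le> k + 1}"
proof -
  have sg: "simple_graph V E" using conn by (simp add: connected_graph_def)
  note fin = simple_graph_finite[OF sg]
  let ?R = "{(x, y). {x, y} \<in> E}"
  obtain r where r: "r \<in> V" using conn by (auto simp: connected_graph_def)
  define dist where "dist v = (LEAST k. (r, v) \<in> ?R ^^ k)" for v
  have "\<exists>q. {v, q} \<in> E \<and> dist q < dist v" if v: "v \<in> V" "v \<noteq> r" for v
  proof -
    have "(r, v) \<in> ?R\<^sup>*" using conn r v by (simp add: connected_graph_def)
    then have "\<exists>k. (r, v) \<in> ?R ^^ k" by (rule rtrancl_imp_relpow)
    then have dv: "(r, v) \<in> ?R ^^ dist v" unfolding dist_def by (rule LeastI_ex)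
    then obtain m where m: "dist v = Suc m" using v dv by (cases "dist v") auto
    with dv obtain q where q: "(r, q) \<in> ?R ^^ m" "(q, v) \<in> ?R" by (auto elim: relpow_Suc_E)
    have "dist q \<le> m" unfolding dist_def by (rule Least_le) (rule q(1))
    then show ?thesis using q m by (auto simp: insert_commute)
  qed
  then obtain p where p: "\<And>v. v \<in> V \<Longrightarrow> v \<noteq> r \<Longrightarrow> {v, p v} \<in> E \<and> dist (p v) < dist v"
    by metis
  define cutset where "cutset S = {v \<in> V. if v = r then r \<in> S else (v \<in> S) \<noteq> (p v \<in> S)}" for S
  show ?thesis
  proof (rule card_inj_on_le)
    show "inj_on cutset {S. S \<subseteq> V \<and> ecount E S (V - S) \<le> k}"
    proof (rule inj_onI, clarsimp)
      fix S S' assume sub: "S \<subseteq> V" "S' \<subseteq> V" and eq: "cutset S = cutset S'"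
      \<comment> \<open>Membership is decoded from the root outwards, by induction on the
        distance.\<close>
      have "v \<in> V \<Longrightarrow> (v \<in> S) = (v \<in> S')" for v
      proof (induction "dist v" arbitrary: v rule: less_induct)
        case less
        have *: "(v \<in> cutset S) = (v \<in> cutset S')" using eq by simp
        show ?case
        proof (cases "v = r")
          case True
          then show ?thesis using * r by (simp add: cutset_def)
        next
          case False
          have pv: "p v \<in> V" "dist (p v) < dist v"
            using p[OF less.prems False] simple_graph_edgeD[OF sg] by blast+
          have "(p v \<in> S) = (p v \<in> S')" by (rule less.hyps[OF pv(2) pv(1)])
          then show ?thesis using * less.prems False by (auto simp: cutset_def)
        qed
      qed
      then show "S = S'" using sub by blast
    qed
    show "cutset ` {S. S \<subseteq> V \<and> ecount E S (V - S) \<le> k} \<subseteq> {D. D \<subseteq> V \<and> real (card D) \<le> k + 1}"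
    proof (rule image_subsetI, clarsimp)
      fix S assume S: "S \<subseteq> V" and cut: "ecount E S (V - S) \<le> k"
      let ?X = "{(x, y). x \<in> S \<and> y \<in> V - S \<and> {x, y} \<in> E}"
      \<comment> \<open>The parent edge is oriented from \<open>S\<close> outwards. Two vertices
        with the same parent edge would be each other's parents, contradicting the decrease of
        \<open>dist\<close>.\<close>
      let ?h = "\<lambda>v. if v \<in> S then (v, p v) else (p v, v)"
      have finX: "finite ?X"
        by (rule finite_subset[of _ "V \<times> V"]) (use S fin in auto)
      have "card (cutset S - {r}) \<le> card ?X"
      proof (rule card_inj_on_le[of ?h])
        show "inj_on ?h (cutset S - {r})"
        proof (rule inj_onI)
          fix v w assume v: "v \<in> cutset S - {r}" and w: "w \<in> cutset S - {r}" and h: "?h v = ?h w"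
          show "v = w"
          proof (rule ccontr)
            assume "v \<noteq> w"
            then have "p v = w \<and> p w = v" using h by (auto split: if_splits)
            moreover have "dist (p v) < dist v" "dist (p w) < dist w"
              using v w p by (auto simp: cutset_def)
            ultimately show False by simp
          qed
        qed
        show "?h ` (cutset S - {r}) \<subseteq> ?X"
        proof (rule image_subsetI)
          fix v assume v: "v \<in> cutset S - {r}"
          then have "{v, p v} \<in> E" "(v \<in> S) \<noteq> (p v \<in> S)" "v \<in> V" using p by (auto simp: cutset_def)
          then show "?h v \<in> ?X"
            using simple_graph_edgeD[OF sg, of v "p v"] by (auto simp: insert_commute)
        qed
      qed (rule finX)
      \<comment> \<open>The root adds at most one element, which is the 1 in
        \<open>k + 1\<close>.\<close>
      moreover have "card (cutset S) \<le> card (cutset S - {r}) + 1"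
        by (simp add: card_Diff_singleton_if, arith)
      moreover have "real (card ?X) \<le> k"
        using cut ecount_eq_card[of S "V - S" E] finite_subset[OF S fin(1)] fin(1) by simp
      ultimately have "real (card (cutset S)) \<le> k + 1" by linarith
      then show "cutset S \<subseteq> V \<and> real (card (cutset S)) \<le> k + 1" by (auto simp: cutset_def)
    qed
    show "finite {D. D \<subseteq> V \<and> real (card D) \<le> k + 1}" using fin by simp
  qed
qed

section \<open>Union bounds for random edges inside and across vertex sets\<close>

lemma card_nsets_2_le: "finite S \<Longrightarrow> 2 * real (card (nsets S 2)) \<le> real (card S) * real (card S)"
proof -
  assume "finite S"
  then have "card (nsets S 2) = card S * (card S - 1) div 2"
    by (simp add: choose_two)
  then have "2 * card (nsets S 2) \<le> card S * card S"
    by (metis diff_le_self div_times_less_eq_dividend le_trans mult.commute mult_le_mono2)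
  then have "real (2 * card (nsets S 2)) \<le> real (card S * card S)" by (rule of_nat_mono)
  then show ?thesis by simp
qed

lemma gnp_edges_tail:
  assumes "0 < n" "0 < \<delta>" "\<delta> \<le> real n"
  shows "measure_pmf.prob (gnp n (\<delta> / real n)) {R. (\<delta> + 1) * real n \<le> real (card (R \<inter> nsets {1..n} 2))}
    \<le> exp (- real n)"
proof -
  let ?N = "real (card (nsets {1..n} 2))"
  have "measure_pmf.prob (gnp n (\<delta> / real n)) {R. (\<delta> + 1) * real n \<le> real (card (R \<inter> nsets {1..n} 2))}
      \<le> exp (2 * (\<delta> / real n) * ?N - (\<delta> + 1) * real n)"
    using assms by (intro gnp_upper_tail) auto
  also have "2 * (\<delta> / real n) * ?N = \<delta> / real n * (2 * ?N)" by simp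
  also have "\<dots> \<le> \<delta> / real n * (real n * real n)"
    using assms card_nsets_2_le[of "{1..n}"] by (intro mult_left_mono) auto
  also have "\<dots> = \<delta> * real n" using assms by simp
  finally show ?thesis by (simp add: algebra_simps)
qed

lemma gnp_inside_tail:
  assumes "0 < n" "0 < \<delta>" "\<delta> \<le> real n"
  shows "measure_pmf.prob (gnp n (\<delta> / real n))
      {R. \<exists>S\<in>{S. S \<subseteq> {1..n} \<and> real (card S) \<le> \<gamma> * real n}. a * real n \<le> real (card (R \<inter> nsets S 2))}
    \<le> real (card {S. S \<subseteq> {1..n} \<and> real (card S) \<le> \<gamma> * real n}) * exp ((\<delta> * \<gamma> - a) * real n)"
proof (rule measure_pmf_UN_le)
  fix S assume "S \<in> {S. S \<subseteq> {1..n} \<and> real (card S) \<le> \<gamma> * real n}"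
  then have S: "S \<subseteq> {1..n}" "real (card S) \<le> \<gamma> * real n" by auto
  have finS: "finite S" using S finite_subset by blast
  have "card S \<le> n" using card_mono[OF _ S(1)] by simp
  let ?N = "real (card (nsets S 2))"
  have "measure_pmf.prob (gnp n (\<delta> / real n)) {R. a * real n \<le> real (card (R \<inter> nsets S 2))}
      \<le> exp (2 * (\<delta> / real n) * ?N - a * real n)"
    using assms nsets_mono[OF S(1)] by (intro gnp_upper_tail) auto
  also have "2 * (\<delta> / real n) * ?N = \<delta> / real n * (2 * ?N)" by simp
  also have "\<dots> \<le> \<delta> / real n * (real (card S) * real (card S))"
    using assms card_nsets_2_le[OF finS] by (intro mult_left_mono) auto
  \<comment> \<open>One factor is bounded by \<open>\<gamma> * n\<close>, the other only by
    \<open>n\<close>: an exponent linear in \<open>\<gamma>\<close> suffices.\<close>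
  also have "\<dots> \<le> \<delta> / real n * ((\<gamma> * real n) * real n)"
    using assms S \<open>card S \<le> n\<close> by (intro mult_left_mono mult_mono) auto
  also have "\<dots> = \<delta> * \<gamma> * real n" using assms by simp
  finally show "measure_pmf.prob (gnp n (\<delta> / real n)) {R. a * real n \<le> real (card (R \<inter> nsets S 2))}
      \<le> exp ((\<delta> * \<gamma> - a) * real n)"
    by (simp add: algebra_simps)
qed simp

text \<open>Only sets that \<open>G\<close> itself cuts rarely enter the union bound, and
  connectivity makes these few. Each balanced one has at least \<open>\<gamma> * n * (n / 2)\<close>
  potential crossing edges, which gives the term \<open>\<delta> * \<gamma> / 4\<close> in the
  exponent.\<close>

lemma gnp_cut_tail:
  assumes "0 < n" "0 < \<delta>" "\<delta> \<le> real n" "0 < \<gamma>" and conn: "connected_graph {1..n} G"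
  shows "measure_pmf.prob (gnp n (\<delta> / real n))
      {R. \<exists>S\<in>{S. S \<subseteq> {1..n} \<and> ecount G S ({1..n} - S) \<le> c * real n}.
        \<gamma> * real n < real (card S) \<and> \<gamma> * real n < real (card ({1..n} - S)) \<and> ecount R S ({1..n} - S) \<le> c * real n}
    \<le> real (card {D. D \<subseteq> {1..n} \<and> real (card D) \<le> c * real n + 1}) * exp ((c - \<delta> * \<gamma> / 4) * real n)"
proof -
  let ?V = "{1..n}"
  let ?F = "{S. S \<subseteq> ?V \<and> ecount G S (?V - S) \<le> c * real n}"
  have "measure_pmf.prob (gnp n (\<delta> / real n))
      {R. \<exists>S\<in>?F. \<gamma> * real n < real (card S) \<and> \<gamma> * real n < real (card (?V - S)) \<and> ecount R S (?V - S) \<le> c * real n}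
    \<le> real (card ?F) * exp ((c - \<delta> * \<gamma> / 4) * real n)"
  proof (rule measure_pmf_UN_le)
    fix S assume "S \<in> ?F"
    then have S: "S \<subseteq> ?V" by simp
    have fin: "finite S" "finite (?V - S)" using S finite_subset by blast+
    define F where "F = (\<lambda>(x, y). {x, y}) ` (S \<times> (?V - S))"
    show "measure_pmf.prob (gnp n (\<delta> / real n)) {R. \<gamma> * real n < real (card S) \<and>
        \<gamma> * real n < real (card (?V - S)) \<and> ecount R S (?V - S) \<le> c * real n} \<le> exp ((c - \<delta> * \<gamma> / 4) * real n)"
    proof (cases "\<gamma> * real n < real (card S) \<and> \<gamma> * real n < real (card (?V - S))")
      case False
      then have "{R. \<gamma> * real n < real (card S) \<and> \<gamma> * real n < real (card (?V - S)) \<and>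
          ecount R S (?V - S) \<le> c * real n} = {}" by auto
      then show ?thesis by (simp only:) simp
    next
      case True
      have sum: "real (card S) + real (card (?V - S)) = real n"
        using card_Diff_subset[OF fin(1) S] card_mono[OF _ S] by (simp add: of_nat_diff)
      have cardF: "real (card F) = real (card S) * real (card (?V - S))"
        using ecount_cross(2)[OF fin] unfolding F_def by simp
      \<comment> \<open>One side has at least half of the vertices, the other more than
        \<open>\<gamma> * n\<close>.\<close>
      have big: "\<gamma> * real n * (real n / 2) \<le> real (card F)"
      proof (cases "real n / 2 \<le> real (card S)")
        case True': True
        have "\<gamma> * real n * (real n / 2) \<le> real (card (?V - S)) * real (card S)"
          using True True' assms by (intro mult_mono) auto
        then show ?thesis by (simp add: cardF mult.commute)
      next
        case False
        then have "\<gamma> * real n * (real n / 2) \<le> real (card S) * real (card (?V - S))"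
          using True sum assms by (intro mult_mono) auto
        then show ?thesis by (simp add: cardF)
      qed
      have FV: "F \<subseteq> nsets ?V 2" using S by (auto simp: F_def)
      have "{R. \<gamma> * real n < real (card S) \<and> \<gamma> * real n < real (card (?V - S)) \<and>
          ecount R S (?V - S) \<le> c * real n} = {R. real (card (R \<inter> F)) \<le> c * real n}"
        using True ecount_cross(1)[OF fin] by (auto simp: F_def)
      then have "measure_pmf.prob (gnp n (\<delta> / real n)) {R. \<gamma> * real n < real (card S) \<and>
          \<gamma> * real n < real (card (?V - S)) \<and> ecount R S (?V - S) \<le> c * real n}
          \<le> exp (c * real n - \<delta> / real n * real (card F) / 2)"
        using gnp_lower_tail[OF FV, of "\<delta> / real n"] assms by simp
      also have "\<dots> \<le> exp (c * real n - \<delta> / real n * (\<gamma> * real n * (real n / 2)) / 2)"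
        using big assms by (intro iffD2[OF exp_le_cancel_iff] diff_left_mono divide_right_mono mult_left_mono) auto
      also have "c * real n - \<delta> / real n * (\<gamma> * real n * (real n / 2)) / 2 = (c - \<delta> * \<gamma> / 4) * real n"
        using assms by (simp add: field_simps)
      finally show ?thesis .
    qed
  qed simp
  also have "\<dots> \<le> real (card {D. D \<subseteq> ?V \<and> real (card D) \<le> c * real n + 1}) * exp ((c - \<delta> * \<gamma> / 4) * real n)"
    using card_small_cuts_le[OF conn, of "c * real n"] by (intro mult_right_mono) auto
  finally show ?thesis .
qed

section \<open>Typical perturbations\<close>

text \<open>The first condition makes the volume linear in \<open>n\<close>. The second, together
  with degeneracy, prevents small sets from keeping their volume inside; \<open>\<eta> / 8\<close>
  is a quarter of the allowed \<open>\<eta> / 2\<close>. The third treats all remaining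
  cuts.\<close>

definition typical :: "real \<Rightarrow> real \<Rightarrow> real \<Rightarrow> real \<Rightarrow> nat \<Rightarrow> nat set set \<Rightarrow> nat set set \<Rightarrow> bool" where
  "typical \<delta> \<eta> \<gamma> c n G R \<longleftrightarrow>
     real (card (R \<inter> nsets {1..n} 2)) < (\<delta> + 1) * real n \<and>
     (\<forall>S \<subseteq> {1..n}. real (card S) \<le> \<gamma> * real n \<longrightarrow> real (card (R \<inter> nsets S 2)) < \<eta> / 8 * real n) \<and>
     (\<forall>S \<subseteq> {1..n}. \<gamma> * real n < real (card S) \<longrightarrow> \<gamma> * real n < real (card ({1..n} - S)) \<longrightarrow>
        c * real n < ecount (G \<union> R) S ({1..n} - S))"

text \<open>The order of choice matters: \<open>\<gamma>\<close> makes the small sets few enough,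
  and only then \<open>c\<close> makes the sets rarely cut by \<open>G\<close> few enough compared
  with the probability, governed by \<open>\<gamma>\<close>, that \<open>R\<close> fails on a fixed
  balanced cut. No constant depends on \<open>G\<close>.\<close>

lemma prob_typical:
  fixes \<delta> \<eta> \<Delta> :: real
  assumes "0 < \<delta>" "0 < \<eta>" "0 \<le> \<Delta>"
  obtains \<gamma> c \<kappa> N where "\<Delta> * \<gamma> \<le> \<eta> / 8" "0 < c" "c \<le> \<eta> / 2" "0 < \<kappa>"
    "\<And>n G. N \<le> n \<Longrightarrow> connected_graph {1..n} G \<Longrightarrow>
      1 - 3 * exp (- \<kappa> * real n) \<le> measure_pmf.prob (gnp n (\<delta> / real n)) {R. typical \<delta> \<eta> \<gamma> c n G R}"
proof -
  \<comment> \<open>Counting small sets costs \<open>\<eta> / 32\<close> in the exponent and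
    \<open>\<delta> * \<gamma>\<close> at most as much again, against a gain of
    \<open>\<eta> / 8\<close>; this leaves \<open>\<eta> / 16\<close> for
    \<open>\<kappa>\<close>.\<close>
  obtain \<gamma>2 where \<gamma>2: "0 < \<gamma>2" "\<And>V :: nat set. finite V \<Longrightarrow>
      real (card {S. S \<subseteq> V \<and> real (card S) \<le> \<gamma>2 * real (card V)}) \<le> exp (\<eta> / 32 * real (card V))"
    using card_small_subsets_exp_rate[of "\<eta> / 32"] assms by auto
  define \<gamma> where "\<gamma> = min \<gamma>2 (min (\<eta> / (32 * \<delta>)) (\<eta> / (8 * (\<Delta> + 1))))"
  have \<gamma>: "0 < \<gamma>" "\<gamma> \<le> \<gamma>2" using \<gamma>2(1) assms by (auto simp: \<gamma>_def)
  have \<delta>\<gamma>: "\<delta> * \<gamma> \<le> \<eta> / 32"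
  proof -
    have "\<gamma> \<le> \<eta> / (32 * \<delta>)" by (simp add: \<gamma>_def)
    then show ?thesis using assms by (simp add: field_simps)
  qed
  have \<Delta>\<gamma>: "\<Delta> * \<gamma> \<le> \<eta> / 8"
  proof -
    have "\<gamma> \<le> \<eta> / (8 * (\<Delta> + 1))" by (simp add: \<gamma>_def)
    then have "(\<Delta> + 1) * \<gamma> \<le> \<eta> / 8" using assms by (simp add: field_simps)
    then show ?thesis using \<gamma> by (simp add: algebra_simps)
  qed
  \<comment> \<open>Here counting and \<open>c\<close> cost at most
    \<open>\<delta> * \<gamma> / 16\<close> each, against a gain of
    \<open>\<delta> * \<gamma> / 4\<close>.\<close>
  obtain \<gamma>3 where \<gamma>3: "0 < \<gamma>3" "\<And>V :: nat set. finite V \<Longrightarrow>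
      real (card {S. S \<subseteq> V \<and> real (card S) \<le> \<gamma>3 * real (card V)}) \<le> exp (\<delta> * \<gamma> / 16 * real (card V))"
    using card_small_subsets_exp_rate[of "\<delta> * \<gamma> / 16"] assms \<gamma> by auto
  define c where "c = min (\<gamma>3 / 2) (min (\<delta> * \<gamma> / 16) (\<eta> / 2))"
  have c: "0 < c" "c \<le> \<eta> / 2" "c \<le> \<gamma>3 / 2" "c \<le> \<delta> * \<gamma> / 16"
    using \<gamma>3(1) assms \<gamma> by (auto simp: c_def)
  define \<kappa> where "\<kappa> = min 1 (min (\<eta> / 16) (\<delta> * \<gamma> / 8))"
  have \<kappa>: "0 < \<kappa>" "\<kappa> \<le> 1" "\<kappa> \<le> \<eta> / 16" "\<kappa> \<le> \<delta> * \<gamma> / 8"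
    using assms \<gamma> by (auto simp: \<kappa>_def)
  \<comment> \<open>This ensures that \<open>\<delta> / n\<close> is a probability and that
    \<open>1 \<le> c * n\<close>, whence \<open>c * n + 1 \<le> \<gamma>3 * n\<close> by the choice
    of \<open>c\<close>.\<close>
  define N where "N = nat \<lceil>max \<delta> (max 1 (1 / c))\<rceil>"
  show thesis
  proof (rule that[OF \<Delta>\<gamma> c(1,2) \<kappa>(1)])
    fix n and G :: "nat set set" assume n: "N \<le> n" and conn: "connected_graph {1..n} G"
    have n': "\<delta> \<le> real n" "1 \<le> real n" "1 / c \<le> real n"
      using n by (auto simp: N_def nat_le_iff ceiling_le_iff max_def split: if_splits)
    then have n0: "0 < n" and cn: "1 \<le> c * real n" using c by (auto simp: field_simps)
    let ?V = "{1..n}" and ?M = "gnp n (\<delta> / real n)"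
    let ?A = "{R. (\<delta> + 1) * real n \<le> real (card (R \<inter> nsets ?V 2))}"
    let ?B = "{R. \<exists>S\<in>{S. S \<subseteq> ?V \<and> real (card S) \<le> \<gamma> * real n}. \<eta> / 8 * real n \<le> real (card (R \<inter> nsets S 2))}"
    let ?C = "{R. \<exists>S\<in>{S. S \<subseteq> ?V \<and> ecount G S (?V - S) \<le> c * real n}.
        \<gamma> * real n < real (card S) \<and> \<gamma> * real n < real (card (?V - S)) \<and> ecount R S (?V - S) \<le> c * real n}"
    have exp_le: "exp (- a * real n) \<le> exp (- \<kappa> * real n)" if "\<kappa> \<le> a" for a
      using that by (simp add: mult_right_mono)
    have A: "measure_pmf.prob ?M ?A \<le> exp (- \<kappa> * real n)"
      by (rule order_trans[OF gnp_edges_tail[OF n0 assms(1) n'(1)]]) (use exp_le[OF \<kappa>(2)] in simp)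
    have B: "measure_pmf.prob ?M ?B \<le> exp (- \<kappa> * real n)"
    proof -
      have "card {S. S \<subseteq> ?V \<and> real (card S) \<le> \<gamma> * real n} \<le> card {S. S \<subseteq> ?V \<and> real (card S) \<le> \<gamma>2 * real (card ?V)}"
        using mult_right_mono[OF \<gamma>(2), of "real n"] by (intro card_mono) auto
      then have "real (card {S. S \<subseteq> ?V \<and> real (card S) \<le> \<gamma> * real n}) \<le> exp (\<eta> / 32 * real n)"
        using \<gamma>2(2)[of ?V] by simp
      then have "measure_pmf.prob ?M ?B \<le> exp (\<eta> / 32 * real n) * exp ((\<delta> * \<gamma> - \<eta> / 8) * real n)"
        using gnp_inside_tail[OF n0 assms(1) n'(1), of \<gamma> "\<eta> / 8"]
        by (elim order_trans[rotated] order_trans mult_right_mono) auto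
      also have "\<dots> = exp (- (\<eta> / 8 - \<eta> / 32 - \<delta> * \<gamma>) * real n)"
        unfolding exp_add[symmetric] by (simp add: algebra_simps)
      also have "\<dots> \<le> exp (- \<kappa> * real n)" using \<delta>\<gamma> \<kappa>(3) by (intro exp_le) linarith
      finally show ?thesis .
    qed
    have C: "measure_pmf.prob ?M ?C \<le> exp (- \<kappa> * real n)"
    proof -
      have "c * real n + 1 \<le> \<gamma>3 * real n"
        using cn c(3) mult_right_mono[OF c(3), of "real n"] by simp
      then have "card {D. D \<subseteq> ?V \<and> real (card D) \<le> c * real n + 1} \<le> card {D. D \<subseteq> ?V \<and> real (card D) \<le> \<gamma>3 * real (card ?V)}"
        by (intro card_mono) auto
      then have "real (card {D. D \<subseteq> ?V \<and> real (card D) \<le> c * real n + 1}) \<le> exp (\<delta> * \<gamma> / 16 * real n)"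
        using \<gamma>3(2)[of ?V] by simp
      then have "measure_pmf.prob ?M ?C \<le> exp (\<delta> * \<gamma> / 16 * real n) * exp ((c - \<delta> * \<gamma> / 4) * real n)"
        using gnp_cut_tail[OF n0 assms(1) n'(1) \<gamma>(1) conn, of c]
        by (elim order_trans[rotated] order_trans mult_right_mono) auto
      also have "\<dots> = exp (- (\<delta> * \<gamma> / 4 - \<delta> * \<gamma> / 16 - c) * real n)"
        unfolding exp_add[symmetric] by (simp add: algebra_simps)
      also have "\<dots> \<le> exp (- \<kappa> * real n)" using c(4) \<kappa>(4) by (intro exp_le) linarith
      finally show ?thesis .
    qed
    have "R \<in> {R. typical \<delta> \<eta> \<gamma> c n G R}" if "R \<notin> ?A \<union> ?B \<union> ?C" for R
    proof -
      have "c * real n < ecount (G \<union> R) S (?V - S)"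
        if "S \<subseteq> ?V" "\<gamma> * real n < real (card S)" "\<gamma> * real n < real (card (?V - S))" for S
      proof -
        \<comment> \<open>Sets not covered by the union bound have enough boundary edges in
          \<open>G\<close> alone.\<close>
        have "c * real n < ecount G S (?V - S) \<or> c * real n < ecount R S (?V - S)"
          using \<open>R \<notin> ?A \<union> ?B \<union> ?C\<close> that by (auto simp: not_le)
        then show ?thesis
          using ecount_mono[of G "G \<union> R" S "?V - S"] ecount_mono[of R "G \<union> R" S "?V - S"] by auto
      qed
      moreover have "real (card (R \<inter> nsets ?V 2)) < (\<delta> + 1) * real n"
        using that by (simp only: Un_iff mem_Collect_eq not_le de_Morgan_disj)
      moreover have "real (card (R \<inter> nsets S 2)) < \<eta> / 8 * real n"
        if "S \<subseteq> ?V" "real (card S) \<le> \<gamma> * real n" for S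
      proof (rule ccontr)
        assume "\<not> ?thesis"
        then have "R \<in> ?B" using that unfolding not_less by blast
        then show False using \<open>R \<notin> ?A \<union> ?B \<union> ?C\<close> by blast
      qed
      ultimately show ?thesis unfolding typical_def mem_Collect_eq by blast
    qed
    then have sub: "- {R. typical \<delta> \<eta> \<gamma> c n G R} \<subseteq> ?A \<union> ?B \<union> ?C" by blast
    have "measure_pmf.prob ?M (- {R. typical \<delta> \<eta> \<gamma> c n G R}) \<le> measure_pmf.prob ?M (?A \<union> ?B \<union> ?C)"
      by (rule measure_pmf.finite_measure_mono[OF sub]) simp
    also have "\<dots> \<le> measure_pmf.prob ?M ?A + measure_pmf.prob ?M ?B + measure_pmf.prob ?M ?C"
      using measure_Un_le[of ?A ?M ?B] measure_Un_le[of "?A \<union> ?B" ?M ?C]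
      by simp
    also have "\<dots> \<le> 3 * exp (- \<kappa> * real n)" using A B C by linarith
    finally show "1 - 3 * exp (- \<kappa> * real n) \<le> measure_pmf.prob ?M {R. typical \<delta> \<eta> \<gamma> c n G R}"
      using measure_pmf.prob_compl[of "{R. typical \<delta> \<eta> \<gamma> c n G R}" ?M] by (simp add: Compl_eq_Diff_UNIV)
  qed
qed

section \<open>Mixing on typical perturbations\<close>

lemma connected_graph_Un:
  assumes "connected_graph V G" "R \<subseteq> nsets V 2"
  shows "connected_graph V (G \<union> R)"
proof -
  have "{(x, y). {x, y} \<in> G}\<^sup>* \<subseteq> {(x, y). {x, y} \<in> G \<union> R}\<^sup>*" by (rule rtrancl_mono) auto
  then have "\<forall>u\<in>V. \<forall>v\<in>V. (u, v) \<in> {(x, y). {x, y} \<in> G \<union> R}\<^sup>*"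
    using assms(1) unfolding connected_graph_def by (meson subsetD)
  then show ?thesis using assms by (simp add: connected_graph_def simple_graph_def)
qed

lemma typical_avg_tv_le:
  fixes \<delta> \<eta> \<gamma> c :: real and \<Delta> T n :: nat and G R :: "nat set set"
  assumes n: "2 \<le> n" and conn: "connected_graph {1..n} G" and dgn: "degenerate \<Delta> {1..n} G"
    and R: "R \<subseteq> nsets {1..n} 2" and typ_R: "typical \<delta> \<eta> \<gamma> c n G R"
    and \<eta>: "0 < \<eta>" "\<eta> \<le> 1 / 3" and \<gamma>: "real \<Delta> * \<gamma> \<le> \<eta> / 8" and c: "0 < c" "c \<le> \<eta> / 2"
    and K: "K = 2 * (real \<Delta> + \<delta> + 1)" "K \<le> real n" "0 < \<delta>" and T: "0 < T"
  shows "\<exists>t<T. 1 / real n * (\<Sum>u\<in>{1..n}. tv_dist {1..n} (walk_dist {1..n} (G \<union> R) u t) (stationary_dist (G \<union> R)))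
    \<le> 2 * sqrt (2 * ln (real n) / real T) / (c / K) + 2 * \<eta>"
proof -
  let ?V = "{1..n}" and ?H = "G \<union> R"
  interpret nontrivial_connected_graph ?V ?H
    using connected_graph_Un[OF conn R] n by unfold_locales auto
  have sgG: "simple_graph ?V G" using conn by (simp add: connected_graph_def)
  have n0: "0 < real n" using n by simp
  have Kpos: "0 < K" using K by simp
  have inside: "ecount ?H S S \<le> 2 * real \<Delta> * real (card S) + 2 * real (card (R \<inter> nsets S 2))" if "S \<subseteq> ?V" for S
    using ecount_Un_le[of G R S S] degenerate_ecount_le[OF sgG dgn that] ecount_inside[OF finite_subset[OF that finV] R]
    by linarith
  have volV: "vol ?H ?V \<le> K * real n"
  proof -
    have "vol ?H ?V \<le> 2 * real \<Delta> * real n + 2 * real (card (R \<inter> nsets ?V 2))"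
      using inside[of ?V] vol_eq_ecount[OF simple order_refl] by simp
    also have "\<dots> \<le> 2 * real \<Delta> * real n + 2 * ((\<delta> + 1) * real n)"
      using typ_R by (simp add: typical_def)
    finally show ?thesis by (simp add: K algebra_simps)
  qed
  \<comment> \<open>Degeneracy and typicality let \<open>S\<close> keep at most
    \<open>\<eta> / 2 * n\<close> of its volume inside, so at least
    \<open>\<eta> / 2 * n \<ge> c * n\<close> leaves.\<close>
  have small: "c * real n \<le> ecount ?H S (?V - S)"
    if S: "S \<subseteq> ?V" "real (card S) \<le> \<gamma> * real n" "\<eta> * real n \<le> vol ?H S" for S
  proof -
    have "ecount ?H S S + ecount ?H S (?V - S) = vol ?H S"
      using ecount_Un_right[of S "?V - S" ?H S] finite_subset[OF S(1)] S(1)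
      by (simp add: vol_eq_ecount[OF simple S(1)] Un_absorb1)
    moreover have "ecount ?H S S \<le> 2 * (\<eta> / 8 * real n) + 2 * (\<eta> / 8 * real n)"
    proof -
      have "real \<Delta> * real (card S) \<le> real \<Delta> * (\<gamma> * real n)" using S by (intro mult_left_mono) auto
      also have "\<dots> \<le> \<eta> / 8 * real n" using mult_right_mono[OF \<gamma>, of "real n"] by (simp add: mult.assoc)
      finally have "real \<Delta> * real (card S) \<le> \<eta> / 8 * real n" .
      moreover have "real (card (R \<inter> nsets S 2)) < \<eta> / 8 * real n"
        using typ_R S by (simp add: typical_def)
      ultimately show ?thesis using inside[OF S(1)] by linarith
    qed
    moreover have "c * real n \<le> \<eta> / 2 * real n" using c by (intro mult_right_mono) auto
    ultimately show ?thesis using S(3) by linarith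
  qed
  \<comment> \<open>The total volume is at most \<open>K * n\<close>, so \<open>c * n\<close>
    boundary edges are at least a fraction \<open>c / K\<close> of it. Either one side is small in
    cardinality or typicality applies directly.\<close>
  have cut: "c / K * vol ?H ?V \<le> ecount ?H S (?V - S)"
    if S: "S \<subseteq> ?V" "\<eta> * real n \<le> vol ?H S" "\<eta> * real n \<le> vol ?H (?V - S)" for S
  proof -
    have "c / K * vol ?H ?V \<le> c / K * (K * real n)"
      using volV c Kpos by (intro mult_left_mono) auto
    also have "\<dots> = c * real n" using Kpos by simp
    also have "\<dots> \<le> ecount ?H S (?V - S)"
    proof -
      consider "real (card S) \<le> \<gamma> * real n" | "real (card (?V - S)) \<le> \<gamma> * real n"
        | "\<gamma> * real n < real (card S)" "\<gamma> * real n < real (card (?V - S))" by linarith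
      then show ?thesis
      proof cases
        case 1
        then show ?thesis using small S by blast
      next
        case 2
        have "?V - (?V - S) = S" using S(1) by blast
        then show ?thesis
          using small[of "?V - S"] 2 S(3) ecount_commute[of ?H S "?V - S"] by auto
      next
        case 3
        then show ?thesis using typ_R S(1) by (simp add: typical_def less_imp_le)
      qed
    qed
    finally show ?thesis .
  qed
  have vol_ge: "real n \<le> vol ?H ?V" using card_le_vol[of ?V] by simp
  have "3 * (\<eta> * real n) \<le> real n" using \<eta> n0 by simp
  then have "3 * (\<eta> * real n) \<le> vol ?H ?V" using vol_ge by linarith
  then obtain B where B: "B \<subseteq> ?V" and volB: "vol ?H B \<le> \<eta> * real n"
    and exp: "\<And>S. S \<subseteq> ?V - B \<Longrightarrow> 2 * vol ?H S \<le> vol ?H (?V - B) \<Longrightarrow> c / K * vol ?H S \<le> ecount ?H S (?V - B - S)"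
    using expander_core[of "c / K" "\<eta> * real n"] cut c Kpos \<eta>(1) by auto
  have "\<eta> * real n \<le> 1 / 3 * real n" using \<eta> by (intro mult_right_mono) auto
  then have volBV: "vol ?H B < vol ?H ?V" using volB vol_ge n0 by linarith
  have "0 < c / K" using c Kpos by simp
  from exists_time_avg_tv_le[OF this B volBV exp T] obtain t where t: "t < T"
    "1 / real n * (\<Sum>u\<in>?V. tv_dist ?V (walk_dist ?V ?H u t) (stationary_dist ?H))
      \<le> 2 * sqrt (ln (vol ?H ?V) / real T) / (c / K) + 2 * vol ?H B / real n"
    by auto
  \<comment> \<open>As \<open>K \<le> n\<close>, the volume is at most \<open>n * n\<close>, and
    \<open>K\<close> disappears from the logarithm.\<close>
  have "ln (vol ?H ?V) \<le> 2 * ln (real n)"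
  proof -
    have "vol ?H ?V \<le> real n * real n"
      using volV mult_right_mono[OF K(2), of "real n"] by simp
    then have "ln (vol ?H ?V) \<le> ln (real n * real n)" using vol_pos by simp
    then show ?thesis using n0 by (simp add: ln_mult)
  qed
  then have "2 * sqrt (ln (vol ?H ?V) / real T) / (c / K) \<le> 2 * sqrt (2 * ln (real n) / real T) / (c / K)"
    using T c Kpos by (intro divide_right_mono mult_left_mono real_sqrt_le_mono) auto
  moreover have "2 * vol ?H B / real n \<le> 2 * \<eta>"
    using volB n0 by (simp add: field_simps)
  ultimately show ?thesis using t by (intro exI[of _ t]) linarith
qed

theorem theorem1p6:
  fixes \<epsilon> \<delta> :: real and \<Delta> :: nat
  assumes "\<epsilon> > 0" and "\<delta> > 0"
  shows "\<exists>C::real. C > 0 \<and>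
    (\<forall>(n :: nat \<Rightarrow> nat) (G :: nat \<Rightarrow> nat set set).
       (\<forall>k. connected_graph {1..n k} (G k) \<and> degenerate \<Delta> {1..n k} (G k)) \<longrightarrow>
       filterlim n at_top sequentially \<longrightarrow>
       (\<lambda>k. measure_pmf.prob (gnp (n k) (\<delta> / real (n k)))
              {R. ereal_of_enat (avg_mixing_time {1..n k} (G k \<union> R) \<epsilon>) \<le> ereal (C * ln (real (n k)))})
         \<longlonglongrightarrow> 1)"
proof -
  \<comment> \<open>The exceptional set costs \<open>2 * \<eta>\<close>, half of the allowed error;
    the bound 1/3 is for the extraction of the expander.\<close>
  define \<eta> where "\<eta> = min (\<epsilon> / 4) (1 / 3)"
  have \<eta>: "0 < \<eta>" "\<eta> \<le> 1 / 3" "2 * \<eta> \<le> \<epsilon> / 2" using assms by (auto simp: \<eta>_def)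
  obtain \<gamma> c \<kappa> N where \<gamma>: "real \<Delta> * \<gamma> \<le> \<eta> / 8" and c: "0 < c" "c \<le> \<eta> / 2" and \<kappa>: "0 < \<kappa>"
    and prob: "\<And>n G. N \<le> n \<Longrightarrow> connected_graph {1..n} G \<Longrightarrow>
      1 - 3 * exp (- \<kappa> * real n) \<le> measure_pmf.prob (gnp n (\<delta> / real n)) {R. typical \<delta> \<eta> \<gamma> c n G R}"
    by (rule prob_typical[OF assms(2) \<eta>(1) of_nat_0_le_iff], rule that)
  define K where "K = 2 * (real \<Delta> + \<delta> + 1)"
  \<comment> \<open>Chosen so that the oscillation term, at most
    \<open>2 * sqrt (4 / C) / (c / K)\<close>, uses the other half of
    \<open>\<epsilon>\<close>.\<close>
  define C where "C = (8 / (c / K * \<epsilon>))\<^sup>2"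
  have Kpos: "0 < K" using assms by (simp add: K_def)
  have Cpos: "0 < C" using Kpos c assms by (simp add: C_def)
  have bound: "1 - 3 * exp (- \<kappa> * real n) \<le> measure_pmf.prob (gnp n (\<delta> / real n))
      {R. ereal_of_enat (avg_mixing_time {1..n} (G \<union> R) \<epsilon>) \<le> ereal (C * ln (real n))}"
    if n: "N \<le> n" "2 \<le> n" "K \<le> real n" "2 \<le> C * ln (real n)"
      and conn: "connected_graph {1..n} G" and dgn: "degenerate \<Delta> {1..n} G" for n G
  proof -
    \<comment> \<open>Rounding down loses at most a factor 2 because \<open>C * ln n\<close> is at
      least 2.\<close>
    define T where "T = nat \<lfloor>C * ln (real n)\<rfloor>"
    have T: "real T \<le> C * ln (real n)" "C * ln (real n) / 2 \<le> real T" "0 < T"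
      using n(4) unfolding T_def by linarith+
    have "2 * sqrt (2 * ln (real n) / real T) / (c / K) \<le> \<epsilon> / 2"
    proof -
      have "2 * ln (real n) / real T \<le> 4 / C"
      proof -
        have "2 * ln (real n) * C \<le> 4 * real T" using T(2) by (simp add: mult.commute)
        then show ?thesis using T(3) Cpos by (simp add: field_simps)
      qed
      then have "sqrt (2 * ln (real n) / real T) \<le> sqrt (4 / C)" by (rule real_sqrt_le_mono)
      also have "\<dots> = 2 / (8 / (c / K * \<epsilon>))"
        using c Kpos assms by (simp add: C_def real_sqrt_divide)
      also have "\<dots> = c / K * \<epsilon> / 4" by (simp add: mult_ac)
      finally have "2 * sqrt (2 * ln (real n) / real T) / (c / K) \<le> 2 * (c / K * \<epsilon> / 4) / (c / K)"
        using c Kpos by (intro divide_right_mono mult_left_mono) auto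
      also have "\<dots> = \<epsilon> / 2" using c Kpos by simp
      finally show ?thesis .
    qed
    then have fast: "ereal_of_enat (avg_mixing_time {1..n} (G \<union> R) \<epsilon>) \<le> ereal (C * ln (real n))"
      if R: "R \<subseteq> nsets {1..n} 2" and typ_R: "typical \<delta> \<eta> \<gamma> c n G R" for R
    proof -
      obtain t where t: "t < T"
        "1 / real n * (\<Sum>u\<in>{1..n}. tv_dist {1..n} (walk_dist {1..n} (G \<union> R) u t) (stationary_dist (G \<union> R)))
          \<le> 2 * sqrt (2 * ln (real n) / real T) / (c / K) + 2 * \<eta>"
        using typical_avg_tv_le[OF n(2) conn dgn R typ_R \<eta>(1,2) \<gamma> c K_def n(3) assms(2) T(3)] by blast
      have "1 / real n * (\<Sum>u\<in>{1..n}. tv_dist {1..n} (walk_dist {1..n} (G \<union> R) u t) (stationary_dist (G \<union> R))) \<le> \<epsilon>"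
        using t(2) \<open>2 * sqrt (2 * ln (real n) / real T) / (c / K) \<le> \<epsilon> / 2\<close> \<eta>(3) by linarith
      then have "avg_mixing_time {1..n} (G \<union> R) \<epsilon> \<le> enat t"
        unfolding avg_mixing_time_def by (intro Inf_lower) auto
      then have "ereal_of_enat (avg_mixing_time {1..n} (G \<union> R) \<epsilon>) \<le> ereal_of_enat (enat t)"
        by (simp only: ereal_of_enat_le_iff)
      also have "\<dots> = ereal (real t)" by simp
      also have "\<dots> \<le> ereal (C * ln (real n))" using t(1) T(1) by simp
      finally show ?thesis .
    qed
    have "1 - 3 * exp (- \<kappa> * real n) \<le> measure_pmf.prob (gnp n (\<delta> / real n)) {R. typical \<delta> \<eta> \<gamma> c n G R}"
      by (rule prob[OF n(1) conn])
    \<comment> \<open>The inclusion of events is needed only on the support of the random graph,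
      where \<open>R\<close> consists of pairs of vertices.\<close>
    also have "\<dots> \<le> measure_pmf.prob (gnp n (\<delta> / real n))
        {R. ereal_of_enat (avg_mixing_time {1..n} (G \<union> R) \<epsilon>) \<le> ereal (C * ln (real n))}"
      using fast gnp_subset
      by (intro measure_pmf.finite_measure_mono_AE) (auto simp: AE_measure_pmf_iff)
    finally show ?thesis .
  qed
  show ?thesis
  proof (intro exI[of _ C] conjI Cpos allI impI)
    fix n :: "nat \<Rightarrow> nat" and G :: "nat \<Rightarrow> nat set set"
    assume G: "\<forall>k. connected_graph {1..n k} (G k) \<and> degenerate \<Delta> {1..n k} (G k)"
      and lim: "filterlim n at_top sequentially"
    have lim_real: "filterlim (\<lambda>k. real (n k)) at_top sequentially"
      using filterlim_compose[OF filterlim_real_sequentially lim] .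
    have lim_ln: "filterlim (\<lambda>k. C * ln (real (n k))) at_top sequentially"
      using filterlim_tendsto_pos_mult_at_top[OF tendsto_const Cpos filterlim_compose[OF ln_at_top lim_real]] .
    let ?p = "\<lambda>k. measure_pmf.prob (gnp (n k) (\<delta> / real (n k)))
      {R. ereal_of_enat (avg_mixing_time {1..n k} (G k \<union> R) \<epsilon>) \<le> ereal (C * ln (real (n k)))}"
    have ev: "\<forall>\<^sub>F k in sequentially. 1 - 3 * exp (- \<kappa> * real (n k)) \<le> ?p k"
    proof -
      have "\<forall>\<^sub>F k in sequentially. N \<le> n k" "\<forall>\<^sub>F k in sequentially. 2 \<le> n k" "\<forall>\<^sub>F k in sequentially. K \<le> real (n k)"
        "\<forall>\<^sub>F k in sequentially. 2 \<le> C * ln (real (n k))"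
        using lim lim_real lim_ln by (auto simp: filterlim_at_top)
      then show ?thesis
      proof eventually_elim
        case (elim k)
        then show ?case using G by (intro bound) auto
      qed
    qed
    have "filterlim (\<lambda>k. \<kappa> * real (n k)) at_top sequentially"
      using filterlim_tendsto_pos_mult_at_top[OF tendsto_const \<kappa> lim_real] .
    then have "((\<lambda>k. exp (- (\<kappa> * real (n k)))) \<longlongrightarrow> 0) sequentially"
      by (intro filterlim_compose[OF exp_at_bot] filterlim_compose[OF filterlim_uminus_at_bot_at_top])
    then have "(\<lambda>k. 1 - 3 * exp (- (\<kappa> * real (n k)))) \<longlonglongrightarrow> 1 - 3 * 0"
      by (intro tendsto_intros)
    then have lower: "(\<lambda>k. 1 - 3 * exp (- \<kappa> * real (n k))) \<longlonglongrightarrow> 1" by simp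
    show "?p \<longlonglongrightarrow> 1"
      by (rule tendsto_sandwich[OF ev _ lower tendsto_const]) simp
  qed
qed

end
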